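(* Suppose that the bottom topography function $B$ is independent of time. Consider the semi-discrete discontinuous Galerkin--stochastic Galerkin (DG-SG) scheme (E1)--(E3) defined in the context, on a periodic domain $\Omega$, for the skew-symmetric stochastic Galerkin shallow water system. The scheme is well-balanced, and it is 1. entropy conservative, i.e. $\frac{d}{dt}E_{\Delta x}=0$, with the central fluxes $$\widehat f_q=\{\mathcal P(\widehat h_{\Delta x})\widehat u_{\Delta x}\},\qquad \widehat f_{qu}=\mathcal P(\widehat f_q)\{\widehat u_{\Delta x}\}=\mathcal P\big(\{\mathcal P(\widehat h_{\Delta x})\widehat u_{\Delta x}\}\big)\{\widehat u_{\Delta x}\};$$ 2. entropy stable, i.e. $\frac{d}{dt}E_{\Delta x}\le 0$, with the Lax--Friedrichs type numerical fluxes $$\widehat f_q=\{\mathcal P(\widehat h_{\Delta x})\widehat u_{\Delta x}\}-\tfrac12\alpha_1\llbracket\widehat h_{\Delta x}+\widehat B_{\Delta x}\rrbracket,$$ $$\widehat f_{qu}=\mathcal P\big(\{\mathcal P(\widehat h_{\Delta x})\widehat u_{\Delta x}\}\big)\{\widehat u_{\Delta x}\}-\tfrac12\alpha_1\llbracket\mathcal P(\widehat h_{\Delta x}+\widehat B_{\Delta x})\widehat u_{\Delta x}\rrbracket,$$ for any $\alpha_1\ge 0$. Here $$E_{\Delta x}=\sum_{\mathcal I_i\subset\Omega}\int_{\mathcal I_i}\Big(\tfrac12 g\|\widehat h_{\Delta x}\|_{\ell^2}^2+g\,\widehat h_{\Delta x}^\top\widehat B_{\Delta x}+\tfrac12\widehat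 q_{\Delta x}^\top\widehat u_{\Delta x}\Big)dx,$$ and well-balanced means that stochastic lake-at-rest states are equilibrium states of the scheme: if at $t=0$ one has $\widehat q_{\Delta x}\equiv\mathbf 0$ and $\widehat h_{\Delta x}+\widehat B_{\Delta x}\equiv\widehat C$ on $\Omega$ for some constant vector $\widehat C\in\mathbb{R}^K$, then $\widehat q_{\Delta x}\equiv\mathbf 0$ and $\widehat h_{\Delta x}+\widehat B_{\Delta x}\equiv\widehat C$ for all $(x,t)\in\Omega\times[0,T]$.
   Context: Stochastic basis. Let $\rho$ be a probability density on $\mathbb{R}^d$ with finite polynomial moments of all orders, and let $\phi_1\equiv1,\phi_2,\dots$ be real $d$-variate polynomials orthonormal with respect to $\langle f_1,f_2\rangle_\rho=\int f_1 f_2\,\rho\,ds$. Fix $K\in\mathbb{N}$. For $\widehat z\in\mathbb{R}^K$ set $\mathcal P(\widehat z)=\sum_{k=1}^K\widehat z_k\mathcal M_k\in\mathbb{R}^{K\times K}$ with $(\mathcal M_k)_{l,m}=\langle\phi_k,\phi_l\phi_m\rangle_\rho$, $1\le l,m\le K$. The map $\mathcal P$ is linear, $\mathcal P(\widehat z)$ is symmetric, and $\mathcal P(\widehat a)\widehat b=\mathcal P(\widehat b)\widehat a$. The constant $g>0$ is the gravitational constant. Hatted quantities are length-$K$ vectors of polynomial chaos coefficients of the water height $h$, discharge $q$, velocity $u$ and bottom topography $B=B(x,\xi)$. Mesh and spaces. $\Omega$ is a one-dimensional periodic domain partitioned into elements $\mathcal I_i=[x_{i-1/2},x_{i+1/2}]$;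 $\{\mathcal E_i\}$ is the set of all cell interfaces. For fixed polynomial degree $k\ge0$, $V^k_{\Delta x}=\{v\in L^2(\Omega): v|_{\mathcal I_i}\in\mathbb P_k(\mathcal I_i)\ \forall i\}$, where $\mathbb P_k$ denotes polynomials of degree at most $k$, and $\mathbf V^k_{\Delta x}=(V^k_{\Delta x})^K$. At an interface $x_{i+1/2}$, $a^+$ and $a^-$ denote the limits from $\mathcal I_{i+1}$ and from $\mathcal I_i$ respectively, and $\{a\}=\frac12(a^++a^-)$, $\llbracket a\rrbracket=a^+-a^-$. Scheme. Given the discrete bottom $\widehat B_{\Delta x}\in\mathbf V^k_{\Delta x}$ and numerical fluxes $\widehat f_q,\widehat f_{qu}\in\mathbb{R}^K$ at each interface, find $\widehat h_{\Delta x},\widehat q_{\Delta x},\widehat u_{\Delta x}$ which, for each $t\in[0,T]$, lie in $\mathbf V^k_{\Delta x}$, such that for every $j=1,\dots,K$ (a subscript $j$ denotes the $j$-th component of a vector): (E1) for all $e\in V^k_{\Delta x}$: $$\sum_i\int_{\mathcal I_i}(\widehat h_{\Delta x,j})_t\,e\,dx-\sum_i\int_{\mathcal I_i}\widehat q_{\Delta x,j}\,e_x\,dx-\sum_{\mathcal E_i}(\widehat f_q)_j\llbracket e\rrbracket=0;$$ (E2) for all $v\in V^k_{\Delta x}$: $$\begin{aligned}&\sum_i\int_{\mathcal I_i}(\widehat q_{\Delta x,j})_t\,v\,dx-\sum_i\int_{\mathcal I_i}\big(\mathcal P(\widehat q_{\Delta x})\widehat u_{\Delta x}\big)_j v_x\,dx-\sum_{\mathcal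 E_i}(\widehat f_{qu})_j\llbracket v\rrbracket\\&+\sum_i\int_{\mathcal I_i}g\Big(\mathcal P\big((\widehat h_{\Delta x}+\widehat B_{\Delta x})_x\big)\,(v\,\widehat h_{\Delta x})\Big)_j dx+\sum_{\mathcal E_i}g\Big(\mathcal P(\llbracket\widehat h_{\Delta x}+\widehat B_{\Delta x}\rrbracket)\{v\,\widehat h_{\Delta x}\}\Big)_j\\&-\sum_i\int_{\mathcal I_i}\tfrac12\big(\mathcal P((\widehat h_{\Delta x})_t)\widehat u_{\Delta x}\big)_j v\,dx+\sum_i\int_{\mathcal I_i}\tfrac12\Big(\mathcal P(\widehat q_{\Delta x})(v\,\widehat u_{\Delta x})_x\Big)_j dx+\sum_{\mathcal E_i}\tfrac12\Big(\mathcal P(\widehat f_q)\llbracket v\,\widehat u_{\Delta x}\rrbracket\Big)_j=0;\end{aligned}$$ (E3) for all $w\in V^k_{\Delta x}$: $$\sum_i\int_{\mathcal I_i}\big(\mathcal P(\widehat h_{\Delta x})\widehat u_{\Delta x}-\widehat q_{\Delta x}\big)_j\,w\,dx=0.$$ This scheme discretizes the skew-symmetric stochastic Galerkin shallow water system $\widehat h_t+\widehat q_x=0$, $\widehat q_t+(\mathcal P(\widehat q)\widehat u)_x+g\mathcal P(\widehat h)(\widehat h+\widehat B)_x-\frac12\mathcal P(\widehat h_t)\widehat u-\frac12\mathcal P(\widehat q_x)\widehat u=0$ with $\widehat u=\mathcal P(\widehat h)^{-1}\widehat q$.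
   Formalization: Entropy stability for the Lax–Friedrichs fluxes assumes P({h+B}) positive semidefinite at all interfaces at the given time (it is false otherwise, e.g. for negative h+B); well-balancedness assumes (E3) determines u uniquely from q at the initial h. *)

theory Defs
  imports "HOL-Analysis.Analysis" "HOL-Computational_Algebra.Polynomial"
begin

section \<open>Stochastic basis and the matrix $\mathcal P$\<close>

definition prob_density_moments :: "(real^'d \<Rightarrow> real) \<Rightarrow> bool" where
  "prob_density_moments \<rho> \<longleftrightarrow>
     \<rho> \<in> borel_measurable borel \<and> (\<forall>s. 0 \<le> \<rho> s) \<and> integral\<^sup>L lborel \<rho> = 1 \<and>
     (\<forall>p. real_polynomial_function p \<longrightarrow> integrable lborel (\<lambda>s. p s * \<rho> s))"

definition ip :: "(real^'d \<Rightarrow> real) \<Rightarrow> (real^'d \<Rightarrow> real) \<Rightarrow> (real^'d \<Rightarrow> real) \<Rightarrow> real" where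
  "ip \<rho> f1 f2 = (LINT s|lborel. f1 s * f2 s * \<rho> s)"

definition orthonormal_poly_seq :: "(real^'d \<Rightarrow> real) \<Rightarrow> (nat \<Rightarrow> real^'d \<Rightarrow> real) \<Rightarrow> bool" where
  "orthonormal_poly_seq \<rho> \<phi> \<longleftrightarrow>
     \<phi> 1 = (\<lambda>_. 1) \<and>
     (\<forall>k\<ge>1. real_polynomial_function (\<phi> k)) \<and>
     (\<forall>k\<ge>1. \<forall>l\<ge>1. ip \<rho> (\<phi> k) (\<phi> l) = (if k = l then 1 else 0))"

text \<open>The index type \<open>'K\<close> plays the role of $\{1,\dots,K\}$, with $K = $ \<open>CARD('K)\<close>;
  \<open>\<psi>\<close> is the basis truncated to its first $K$ members and reindexed by \<open>'K\<close>.\<close>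

definition triple_matrix ::
    "(real^'d \<Rightarrow> real) \<Rightarrow> ('K::finite \<Rightarrow> real^'d \<Rightarrow> real) \<Rightarrow> 'K \<Rightarrow> real^'K^'K" where
  "triple_matrix \<rho> \<psi> k = (\<chi> l m. ip \<rho> (\<psi> k) (\<lambda>s. \<psi> l s * \<psi> m s))"

definition pc_matrix ::
    "(real^'d \<Rightarrow> real) \<Rightarrow> ('K::finite \<Rightarrow> real^'d \<Rightarrow> real) \<Rightarrow> real^'K \<Rightarrow> real^'K^'K" where
  "pc_matrix \<rho> \<psi> z = (\<Sum>k\<in>UNIV. (z $ k) *\<^sub>R triple_matrix \<rho> \<psi> k)"


section \<open>Periodic mesh and discontinuous piecewise polynomials\<close>

text \<open>Element \<open>i < N\<close> is \<open>{X i..X (Suc i)}\<close>, and \<open>X 0\<close> is identified with \<open>X N\<close>.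
  A member of the DG space is given by its polynomial on each element (values of such a family
  at indices \<open>i \<ge> N\<close> are irrelevant), so that traces and the elementwise derivative are
  those of the polynomials. A general function on the broken mesh has type
  \<open>nat \<Rightarrow> real \<Rightarrow> _\<close> (element index, point of that element).\<close>

definition periodic_mesh :: "nat \<Rightarrow> (nat \<Rightarrow> real) \<Rightarrow> bool" where
  "periodic_mesh N X \<longleftrightarrow> 0 < N \<and> (\<forall>i<N. X i < X (Suc i))"

definition DG :: "nat \<Rightarrow> nat \<Rightarrow> (nat \<Rightarrow> real poly) set" where
  "DG N k = {v. \<forall>i<N. degree (v i) \<le> k}"

type_synonym 'K dgvec = "nat \<Rightarrow> (real poly)^'K"

definition DGvec :: "nat \<Rightarrow> nat \<Rightarrow> ('K::finite) dgvec set" where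
  "DGvec N k = {a. \<forall>j. (\<lambda>i. a i $ j) \<in> DG N k}"

definition val :: "('K::finite) dgvec \<Rightarrow> nat \<Rightarrow> real \<Rightarrow> real^'K" where
  "val a i x = (\<chi> j. poly (a i $ j) x)"

definition dx :: "('K::finite) dgvec \<Rightarrow> nat \<Rightarrow> real \<Rightarrow> real^'K" where
  "dx a i x = (\<chi> j. poly (pderiv (a i $ j)) x)"

definition smul :: "(nat \<Rightarrow> real poly) \<Rightarrow> ('K::finite) dgvec \<Rightarrow> 'K dgvec" where
  "smul v a = (\<lambda>i. \<chi> j. v i * a i $ j)"

text \<open>Interface \<open>i < N\<close> is the right end of element \<open>i\<close>; its right neighbour
  is element \<open>Suc i mod N\<close>.\<close>

definition trace_minus :: "(nat \<Rightarrow> real) \<Rightarrow> (nat \<Rightarrow> real \<Rightarrow> 'v) \<Rightarrow> nat \<Rightarrow> 'v" where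
  "trace_minus X F i = F i (X (Suc i))"

definition trace_plus :: "nat \<Rightarrow> (nat \<Rightarrow> real) \<Rightarrow> (nat \<Rightarrow> real \<Rightarrow> 'v) \<Rightarrow> nat \<Rightarrow> 'v" where
  "trace_plus N X F i = F (Suc i mod N) (X (Suc i mod N))"

definition avg ::
    "nat \<Rightarrow> (nat \<Rightarrow> real) \<Rightarrow> (nat \<Rightarrow> real \<Rightarrow> 'v::real_vector) \<Rightarrow> nat \<Rightarrow> 'v" where
  "avg N X F i = (1/2) *\<^sub>R (trace_plus N X F i + trace_minus X F i)"

definition jump ::
    "nat \<Rightarrow> (nat \<Rightarrow> real) \<Rightarrow> (nat \<Rightarrow> real \<Rightarrow> 'v::real_vector) \<Rightarrow> nat \<Rightarrow> 'v" where
  "jump N X F i = trace_plus N X F i - trace_minus X F i"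

definition mesh_int :: "nat \<Rightarrow> (nat \<Rightarrow> real) \<Rightarrow> (nat \<Rightarrow> real \<Rightarrow> real) \<Rightarrow> real" where
  "mesh_int N X f = (\<Sum>i<N. integral {X i..X (Suc i)} (f i))"


section \<open>The scheme\<close>

text \<open>\<open>P\<close> is the map $\mathcal P$; \<open>ht\<close>, \<open>qt\<close> are the time derivatives
  at the given instant; \<open>fq\<close>, \<open>fqu\<close> are the numerical fluxes at the interfaces.\<close>

definition mass_eq ::
    "nat \<Rightarrow> (nat \<Rightarrow> real) \<Rightarrow> nat \<Rightarrow> (nat \<Rightarrow> real^'K::finite) \<Rightarrow> 'K dgvec \<Rightarrow> 'K dgvec \<Rightarrow> bool" where
  "mass_eq N X k fq ht q \<longleftrightarrow> (\<forall>j. \<forall>e \<in> DG N k.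
       mesh_int N X (\<lambda>i x. val ht i x $ j * poly (e i) x)
     - mesh_int N X (\<lambda>i x. val q i x $ j * poly (pderiv (e i)) x)
     - (\<Sum>i<N. fq i $ j * jump N X (\<lambda>i x. poly (e i) x) i) = 0)"

definition momentum_eq ::
    "(real^'K \<Rightarrow> real^'K^'K::finite) \<Rightarrow> nat \<Rightarrow> (nat \<Rightarrow> real) \<Rightarrow> nat \<Rightarrow> real \<Rightarrow> 'K dgvec \<Rightarrow>
     (nat \<Rightarrow> real^'K) \<Rightarrow> (nat \<Rightarrow> real^'K) \<Rightarrow>
     'K dgvec \<Rightarrow> 'K dgvec \<Rightarrow> 'K dgvec \<Rightarrow> 'K dgvec \<Rightarrow> 'K dgvec \<Rightarrow> bool" where
  "momentum_eq P N X k g B fq fqu ht qt h q u \<longleftrightarrow> (\<forall>j. \<forall>v \<in> DG N k.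
       mesh_int N X (\<lambda>i x. val qt i x $ j * poly (v i) x)
     - mesh_int N X (\<lambda>i x. (P (val q i x) *v val u i x) $ j * poly (pderiv (v i)) x)
     - (\<Sum>i<N. fqu i $ j * jump N X (\<lambda>i x. poly (v i) x) i)
     + mesh_int N X (\<lambda>i x. g * (P (dx h i x + dx B i x) *v val (smul v h) i x) $ j)
     + (\<Sum>i<N. g * (P (jump N X (\<lambda>i x. val h i x + val B i x) i)
                     *v avg N X (val (smul v h)) i) $ j)
     - mesh_int N X (\<lambda>i x. 1/2 * (P (val ht i x) *v val u i x) $ j * poly (v i) x)
     + mesh_int N X (\<lambda>i x. 1/2 * (P (val q i x) *v dx (smul v u) i x) $ j)
     + (\<Sum>i<N. 1/2 * (P (fq i) *v jump N X (val (smul v u)) i) $ j) = 0)"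

definition velocity_eq ::
    "(real^'K \<Rightarrow> real^'K^'K::finite) \<Rightarrow> nat \<Rightarrow> (nat \<Rightarrow> real) \<Rightarrow> nat \<Rightarrow>
     'K dgvec \<Rightarrow> 'K dgvec \<Rightarrow> 'K dgvec \<Rightarrow> bool" where
  "velocity_eq P N X k h q u \<longleftrightarrow> (\<forall>j. \<forall>w \<in> DG N k.
     mesh_int N X (\<lambda>i x. (P (val h i x) *v val u i x - val q i x) $ j * poly (w i) x) = 0)"

definition has_time_deriv ::
    "nat \<Rightarrow> (nat \<Rightarrow> real) \<Rightarrow> real \<Rightarrow> (real \<Rightarrow> 'K dgvec) \<Rightarrow> (real \<Rightarrow> ('K::finite) dgvec) \<Rightarrow> bool" where
  "has_time_deriv N X T a a' \<longleftrightarrow> (\<forall>t\<in>{0..T}. \<forall>i<N. \<forall>x\<in>{X i..X (Suc i)}.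
     ((\<lambda>s. val (a s) i x) has_vector_derivative val (a' t) i x) (at t within {0..T}))"

text \<open>\<open>Fq\<close> and \<open>Fqu\<close> give the numerical fluxes as functions of \<open>h\<close> and
  \<open>u\<close>. The velocity is only required to be continuous in time, since its time derivative does
  not enter the scheme. The bottom \<open>B\<close> carries no time argument.\<close>

definition dg_sg_solution ::
    "(real^'K \<Rightarrow> real^'K^'K::finite) \<Rightarrow> nat \<Rightarrow> (nat \<Rightarrow> real) \<Rightarrow> nat \<Rightarrow> real \<Rightarrow> real \<Rightarrow> 'K dgvec \<Rightarrow>
     ('K dgvec \<Rightarrow> 'K dgvec \<Rightarrow> nat \<Rightarrow> real^'K) \<Rightarrow> ('K dgvec \<Rightarrow> 'K dgvec \<Rightarrow> nat \<Rightarrow> real^'K) \<Rightarrow>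
     (real \<Rightarrow> 'K dgvec) \<Rightarrow> (real \<Rightarrow> 'K dgvec) \<Rightarrow> (real \<Rightarrow> 'K dgvec) \<Rightarrow> bool" where
  "dg_sg_solution P N X k g T B Fq Fqu h q u \<longleftrightarrow>
     (\<forall>t\<in>{0..T}. h t \<in> DGvec N k \<and> q t \<in> DGvec N k \<and> u t \<in> DGvec N k) \<and>
     (\<forall>i<N. \<forall>x\<in>{X i..X (Suc i)}. continuous_on {0..T} (\<lambda>t. val (u t) i x)) \<and>
     (\<exists>ht qt.
        (\<forall>t\<in>{0..T}. ht t \<in> DGvec N k \<and> qt t \<in> DGvec N k) \<and>
        has_time_deriv N X T h ht \<and> has_time_deriv N X T q qt \<and>
        (\<forall>t\<in>{0..T}.
           mass_eq N X k (Fq (h t) (u t)) (ht t) (q t) \<and>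
           momentum_eq P N X k g B (Fq (h t) (u t)) (Fqu (h t) (u t)) (ht t) (qt t) (h t) (q t) (u t) \<and>
           velocity_eq P N X k (h t) (q t) (u t)))"


section \<open>Numerical fluxes\<close>

definition central_fq ::
    "(real^'K \<Rightarrow> real^'K^'K::finite) \<Rightarrow> nat \<Rightarrow> (nat \<Rightarrow> real) \<Rightarrow> 'K dgvec \<Rightarrow> 'K dgvec \<Rightarrow> nat \<Rightarrow> real^'K" where
  "central_fq P N X h u i = avg N X (\<lambda>i x. P (val h i x) *v val u i x) i"

definition central_fqu ::
    "(real^'K \<Rightarrow> real^'K^'K::finite) \<Rightarrow> nat \<Rightarrow> (nat \<Rightarrow> real) \<Rightarrow> 'K dgvec \<Rightarrow> 'K dgvec \<Rightarrow> nat \<Rightarrow> real^'K" where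
  "central_fqu P N X h u i =
     P (avg N X (\<lambda>i x. P (val h i x) *v val u i x) i) *v avg N X (val u) i"

definition lf_fq ::
    "(real^'K \<Rightarrow> real^'K^'K::finite) \<Rightarrow> nat \<Rightarrow> (nat \<Rightarrow> real) \<Rightarrow> 'K dgvec \<Rightarrow> real \<Rightarrow>
     'K dgvec \<Rightarrow> 'K dgvec \<Rightarrow> nat \<Rightarrow> real^'K" where
  "lf_fq P N X B \<alpha> h u i =
     avg N X (\<lambda>i x. P (val h i x) *v val u i x) i
     - (1/2 * \<alpha>) *\<^sub>R jump N X (\<lambda>i x. val h i x + val B i x) i"

definition lf_fqu ::
    "(real^'K \<Rightarrow> real^'K^'K::finite) \<Rightarrow> nat \<Rightarrow> (nat \<Rightarrow> real) \<Rightarrow> 'K dgvec \<Rightarrow> real \<Rightarrow>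
     'K dgvec \<Rightarrow> 'K dgvec \<Rightarrow> nat \<Rightarrow> real^'K" where
  "lf_fqu P N X B \<alpha> h u i =
     P (avg N X (\<lambda>i x. P (val h i x) *v val u i x) i) *v avg N X (val u) i
     - (1/2 * \<alpha>) *\<^sub>R jump N X (\<lambda>i x. P (val h i x + val B i x) *v val u i x) i"


section \<open>Entropy and lake at rest\<close>

definition entropy ::
    "nat \<Rightarrow> (nat \<Rightarrow> real) \<Rightarrow> real \<Rightarrow> ('K::finite) dgvec \<Rightarrow> 'K dgvec \<Rightarrow> 'K dgvec \<Rightarrow> 'K dgvec \<Rightarrow> real" where
  "entropy N X g B h q u = mesh_int N X (\<lambda>i x.
     1/2 * g * (norm (val h i x))\<^sup>2 + g * (val h i x \<bullet> val B i x) + 1/2 * (val q i x \<bullet> val u i x))"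

definition lake_at_rest ::
    "nat \<Rightarrow> (nat \<Rightarrow> real) \<Rightarrow> ('K::finite) dgvec \<Rightarrow> real^'K \<Rightarrow> 'K dgvec \<Rightarrow> 'K dgvec \<Rightarrow> bool" where
  "lake_at_rest N X B C h q \<longleftrightarrow>
     (\<forall>i<N. \<forall>x\<in>{X i..X (Suc i)}. val q i x = 0 \<and> val h i x + val B i x = C)"

text \<open>Discrete counterpart of the requirement that $\widehat u = \mathcal P(\widehat h)^{-1}\widehat q$
  be well defined: the weak relation between \<open>h\<close>, \<open>q\<close> and \<open>u\<close> determines
  \<open>u\<close>. Positive definiteness of $\mathcal P(\widehat h)$ is sufficient.\<close>

definition velocity_determined ::
    "(real^'K \<Rightarrow> real^'K^'K::finite) \<Rightarrow> nat \<Rightarrow> (nat \<Rightarrow> real) \<Rightarrow> nat \<Rightarrow> 'K dgvec \<Rightarrow> bool" where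
  "velocity_determined P N X k h \<longleftrightarrow>
     (\<forall>q\<in>DGvec N k. \<forall>u1\<in>DGvec N k. \<forall>u2\<in>DGvec N k.
        velocity_eq P N X k h q u1 \<and> velocity_eq P N X k h q u2 \<longrightarrow> (\<forall>i<N. u1 i = u2 i))"

lemma velocity_determined_if_pos_def:
  fixes h :: "('K::finite) dgvec" and \<rho> :: "real^'d \<Rightarrow> real" and \<psi> :: "'K \<Rightarrow> real^'d \<Rightarrow> real"
  defines "P \<equiv> pc_matrix \<rho> \<psi>"
  assumes mesh: "periodic_mesh N X"
    and pd: "\<And>i x y. \<lbrakk>i < N; x \<in> {X i..X (Suc i)}; y \<noteq> 0\<rbrakk> \<Longrightarrow> 0 < y \<bullet> (P (val h i x) *v y)"
  shows "velocity_determined P N X k h"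
  unfolding velocity_determined_def
proof (intro ballI impI allI)
  fix q u1 u2 :: "'K dgvec" and i0
  assume U: "u1 \<in> DGvec N k" "u2 \<in> DGvec N k" and i0: "i0 < N"
    and V: "velocity_eq P N X k h q u1 \<and> velocity_eq P N X k h q u2"
  define w :: "'K dgvec" where "w = (\<lambda>i. u1 i - u2 i)"
  have valw: "val w i x = val u1 i x - val u2 i x" for i x
    by (simp add: w_def val_def vec_eq_iff)
  have wDG: "(\<lambda>i. w i $ j) \<in> DG N k" for j
    using U by (auto simp: w_def DGvec_def DG_def intro: degree_diff_le)
  have contv: "continuous_on S (\<lambda>x. val a i x $ j)" for S and a :: "'K dgvec" and i j
    by (simp add: val_def continuous_intros)
  have contP: "continuous_on S (\<lambda>x. (P (val h i x) *v val a i x) $ j)"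
    for S and a :: "'K dgvec" and i j
    unfolding P_def pc_matrix_def matrix_vector_mult_def
    by (simp add: sum_component) (intro continuous_intros contv)
  define G where "G i x = val w i x \<bullet> (P (val h i x) *v val w i x)" for i x
  have contG: "continuous_on S (G i)" for S i
    unfolding G_def inner_vec_def by simp (intro continuous_intros contv contP)
  have j0: "mesh_int N X (\<lambda>i x. val w i x $ j * (P (val h i x) *v val w i x) $ j) = 0" for j
  proof -
    have E: "mesh_int N X (\<lambda>i x. (P (val h i x) *v val u i x - val q i x) $ j * val w i x $ j) = 0"
      if "velocity_eq P N X k h q u" for u
      using that wDG[of j] unfolding velocity_eq_def by (simp add: val_def)
    have "mesh_int N X (\<lambda>i x. val w i x $ j * (P (val h i x) *v val w i x) $ j) =
        mesh_int N X (\<lambda>i x. (P (val h i x) *v val u1 i x - val q i x) $ j * val w i x $ j) -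
        mesh_int N X (\<lambda>i x. (P (val h i x) *v val u2 i x - val q i x) $ j * val w i x $ j)"
      unfolding mesh_int_def sum_subtractf[symmetric]
    proof (rule sum.cong[OF refl])
      fix i
      have int: "(\<lambda>x. (P (val h i x) *v val u i x - val q i x) $ j * val w i x $ j)
          integrable_on {X i..X (Suc i)}" for u
        by (rule integrable_continuous_real, simp) (intro continuous_intros contv contP)
      show "integral {X i..X (Suc i)} (\<lambda>x. val w i x $ j * (P (val h i x) *v val w i x) $ j) =
         integral {X i..X (Suc i)}
           (\<lambda>x. (P (val h i x) *v val u1 i x - val q i x) $ j * val w i x $ j) -
         integral {X i..X (Suc i)}
           (\<lambda>x. (P (val h i x) *v val u2 i x - val q i x) $ j * val w i x $ j)"
        unfolding integral_diff[OF int int, symmetric]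
        by (rule integral_cong)
          (simp add: valw matrix_vector_mult_diff_distrib algebra_simps)
    qed
    then show ?thesis using E V by simp
  qed
  have nn: "0 \<le> G i x" if "i < N" "x \<in> {X i..X (Suc i)}" for i x
    using pd[OF that, of "val w i x"] by (cases "val w i x = 0") (auto simp: G_def)
  have "(\<Sum>j\<in>UNIV. mesh_int N X (\<lambda>i x. val w i x $ j * (P (val h i x) *v val w i x) $ j)) =
      mesh_int N X G"
    unfolding mesh_int_def
    by (subst sum.swap, rule sum.cong[OF refl], subst integral_sum[symmetric])
      (auto simp: G_def[abs_def] inner_vec_def
        intro!: integrable_continuous_real continuous_intros contv contP)
  then have "(\<Sum>i<N. integral {X i..X (Suc i)} (G i)) = 0"
    using j0 by (simp add: mesh_int_def)
  moreover have "0 \<le> integral {X i..X (Suc i)} (G i)" if "i < N" for i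
    using nn that by (intro integral_nonneg integrable_continuous_real contG) auto
  ultimately have "integral {X i0..X (Suc i0)} (G i0) = 0"
    using i0 by (subst (asm) sum_nonneg_eq_0_iff) auto
  then have G0: "G i0 x = 0" if "x \<in> {X i0..X (Suc i0)}" for x
    using integral_eq_0_iff[OF contG, of "X i0" "X (Suc i0)" i0] mesh i0 nn[OF i0] that
    by (auto simp: periodic_mesh_def)
  have w0: "val w i0 x = 0" if "x \<in> {X i0..X (Suc i0)}" for x
    using pd[OF i0 that, of "val w i0 x"] G0[OF that] by (auto simp: G_def)
  have "w i0 $ j = 0" for j
  proof (rule ccontr)
    assume "w i0 $ j \<noteq> 0"
    then have "finite {x. poly (w i0 $ j) x = 0}" by (rule poly_roots_finite)
    moreover have "{X i0..X (Suc i0)} \<subseteq> {x. poly (w i0 $ j) x = 0}"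
      using w0 by (auto simp: val_def vec_eq_iff)
    ultimately have "finite {X i0..X (Suc i0)}" by (rule rev_finite_subset)
    then show False using mesh i0 infinite_Icc[of "X i0" "X (Suc i0)"] by (auto simp: periodic_mesh_def)
  qed
  then show "u1 i0 = u2 i0" by (simp add: w_def vec_eq_iff)
qed

text \<open>Needed for the Lax--Friedrichs fluxes, whose entropy production is
  $-\frac{\alpha}{2}\sum (g\,|[\![h+B]\!]|^2 + [\![u]\!]^T \mathcal P(\{h+B\}) [\![u]\!])$:
  without a sign of $\mathcal P(\{h+B\})$ at the interfaces the entropy may grow.\<close>

definition pos_semidef :: "real^'K^'K::finite \<Rightarrow> bool" where
  "pos_semidef A \<longleftrightarrow> transpose A = A \<and> (\<forall>y. 0 \<le> y \<bullet> (A *v y))"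

end

theory Submission
  imports Defs
begin

text \<open>Testing the mass equation with \<open>g (h + B)\<close>, the momentum equation with \<open>u\<close> and the velocity
  equation with \<open>(h + B)\<^sub>x\<close> makes all volume terms cancel, because the trilinear form
  \<open>P a b \<bullet> c\<close> is totally symmetric. What remains of the entropy rate is the interface sum
  \<open>g (f\<^sub>q - {P h u}) \<bullet> [h + B] + (f\<^sub>q\<^sub>u - P f\<^sub>q {u}) \<bullet> [u]\<close>: it vanishes for the central fluxes, and
  for the Lax--Friedrichs fluxes the discrete product rule turns it into
  \<open>- \<alpha>/2 (g |[h + B]|\<^sup>2 + P {h + B} [u] \<bullet> [u])\<close>.

  Lake-at-rest states persist because the scheme has a unique solution. \<open>P h\<close> may be indefinite, so
  the entropy does not control the solution; instead the squared \<open>L\<^sup>2\<close> norm of \<open>h + B - C\<close> and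
  \<open>q\<close> is shown to satisfy a Gronwall inequality on all of \<open>[0, T]\<close>.\<close>

section \<open>Functionals on polynomials\<close>

text \<open>Two obstacles shape the proof. The velocity is only continuous in time, so the product
  rule does not apply to the kinetic energy, and time derivatives are given only pointwise in space.
  Finite dimensionality helps: an exact quadrature turns each spatial integral into a finite sum of
  nodal values, and testing the velocity equation at one time with the velocity of another time
  removes the increment of \<open>u\<close>. For the lake at rest, the velocity is assumed to be
  determined by the weak relation at time 0 alone. Hence \<open>u\<close> is estimated through the
  initial operator \<open>P (h 0)\<close> only, and the change \<open>h - h 0\<close> is treated as
  part of the deviation from rest. The Gronwall constant may depend on the given solution, which is
  bounded on the compact time interval, so no estimate uniform over solutions is sought.\<close>

lemma functional_in_span:
  fixes f :: "'i \<Rightarrow> 'a \<Rightarrow> real" and g :: "'a \<Rightarrow> real"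
  assumes "finite M"
    and "\<And>x y c. x \<in> V \<Longrightarrow> y \<in> V \<Longrightarrow>
      \<exists>z\<in>V. (\<forall>i\<in>M. f i z = f i x + c * f i y) \<and> g z = g x + c * g y"
    and "\<And>x. x \<in> V \<Longrightarrow> \<forall>i\<in>M. f i x = 0 \<Longrightarrow> g x = 0"
  shows "\<exists>c. \<forall>x\<in>V. g x = (\<Sum>i\<in>M. c i * f i x)"
  using assms
proof (induction M arbitrary: V rule: finite_induct)
  case empty
  then show ?case by auto
next
  case (insert m M)
  \<comment> \<open>Induction on the number of functionals, by restriction to the kernel of
    \<open>f m\<close>. \<open>V\<close> carries only as much linear structure as the values of the
    functionals detect, so polynomials of bounded degree and broken polynomial fields are both
    covered.\<close>
  define V' where "V' = {x \<in> V. f m x = 0}"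
  have "\<exists>c. \<forall>x\<in>V'. g x = (\<Sum>i\<in>M. c i * f i x)"
  proof (rule insert.IH)
    fix x y c assume "x \<in> V'" "y \<in> V'"
    then show "\<exists>z\<in>V'. (\<forall>i\<in>M. f i z = f i x + c * f i y) \<and> g z = g x + c * g y"
      using insert.prems(1)[of x y c] by (auto simp: V'_def)
  next
    fix x assume "x \<in> V'" "\<forall>i\<in>M. f i x = 0"
    then show "g x = 0" using insert.prems(2)[of x] by (auto simp: V'_def)
  qed
  then obtain c where c: "\<And>x. x \<in> V' \<Longrightarrow> g x = (\<Sum>i\<in>M. c i * f i x)" by blast
  show ?case
  proof (cases "\<exists>y\<in>V. f m y \<noteq> 0")
    case False
    then have "\<forall>x\<in>V. g x = (\<Sum>i\<in>insert m M. c i * f i x)"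
      using insert.hyps c by (simp add: V'_def)
    then show ?thesis by (rule exI[of _ c])
  next
    case True
    then obtain y where y: "y \<in> V" "f m y \<noteq> 0" by blast
    \<comment> \<open>\<open>r\<close> makes the formula exact at \<open>y\<close>; every other
      \<open>x\<close> differs from a multiple of \<open>y\<close> by something on which
      \<open>f m\<close> vanishes.\<close>
    define r where "r = (g y - (\<Sum>i\<in>M. c i * f i y)) / f m y"
    have "g x = (\<Sum>i\<in>insert m M. (c(m := r)) i * f i x)" if x: "x \<in> V" for x
    proof -
      define s where "s = f m x / f m y"
      obtain z where z: "z \<in> V" "\<forall>i\<in>insert m M. f i z = f i x + (-s) * f i y"
        "g z = g x + (-s) * g y"
        using insert.prems(1)[OF x y(1)] by blast
      have "z \<in> V'" using z y by (simp add: V'_def s_def)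
      have "g x = (\<Sum>i\<in>M. c i * (f i x - s * f i y)) + s * g y"
        using c[OF \<open>z \<in> V'\<close>] z by simp
      also have "\<dots> = (\<Sum>i\<in>M. c i * f i x) + s * (g y - (\<Sum>i\<in>M. c i * f i y))"
        by (simp add: right_diff_distrib sum_subtractf sum_distrib_left mult.left_commute)
      also have "s * (g y - (\<Sum>i\<in>M. c i * f i y)) = r * f m x"
        by (simp add: s_def r_def)
      also have "(\<Sum>i\<in>M. c i * f i x) = (\<Sum>i\<in>M. (c(m := r)) i * f i x)"
        using insert.hyps by (intro sum.cong) auto
      finally show ?thesis using insert.hyps by simp
    qed
    then show ?thesis by blast
  qed
qed

text \<open>A nonzero polynomial of degree at most \<open>n\<close> has at most \<open>n\<close>
  zeros, so evaluations at the nodes separate polynomials and hence span all functionals. For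
  integration, \<open>w\<close> holds interpolatory quadrature weights, whose signs are left
  open.\<close>

lemma poly_functional_nodes:
  fixes L :: "real poly \<Rightarrow> real"
  assumes L: "\<And>p q c. L (p + smult c q) = L p + c * L q" and S: "finite S" "n < card S"
  shows "\<exists>w. \<forall>p. degree p \<le> n \<longrightarrow> L p = (\<Sum>s\<in>S. w s * poly p s)"
proof -
  have "\<exists>w. \<forall>p\<in>{p. degree p \<le> n}. L p = (\<Sum>s\<in>S. w s * poly p s)"
  proof (rule functional_in_span[OF S(1)])
    fix p q :: "real poly" and c :: real
    assume "p \<in> {p. degree p \<le> n}" "q \<in> {p. degree p \<le> n}"
    then show "\<exists>z\<in>{p. degree p \<le> n}. (\<forall>s\<in>S. poly z s = poly p s + c * poly q s) \<and> L z = L p + c * L q"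
      by (intro bexI[of _ "p + smult c q"])
        (auto simp: L intro: degree_add_le order_trans[OF degree_smult_le])
  next
    fix p :: "real poly" assume p: "p \<in> {p. degree p \<le> n}" "\<forall>s\<in>S. poly p s = 0"
    have "p = 0"
    proof (rule ccontr)
      assume "p \<noteq> 0"
      then have "card S \<le> card {x. poly p x = 0}"
        using p poly_roots_finite[of p] by (intro card_mono) auto
      also have "\<dots> \<le> degree p" using \<open>p \<noteq> 0\<close> by (rule card_poly_roots_bound)
      finally show False using p S by simp
    qed
    moreover have "L 0 = 0" using L[of 0 1 0] by simp
    ultimately show "L p = 0" by simp
  qed
  then show ?thesis by simp
qed

lemma poly_eq_0_on_Icc:
  fixes p :: "real poly"
  assumes "a < b" "\<And>x. x \<in> {a..b} \<Longrightarrow> poly p x = 0"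
  shows "p = 0"
proof (rule ccontr)
  assume "p \<noteq> 0"
  then have "finite {x. poly p x = 0}" by (rule poly_roots_finite)
  moreover have "{a..b} \<subseteq> {x. poly p x = 0}" using assms by auto
  ultimately show False using infinite_Icc[OF assms(1)] rev_finite_subset by blast
qed

text \<open>If all moments of \<open>p\<close> against \<open>x ^ m\<close> with
  \<open>m \<le> n\<close> vanish, then \<open>p\<close> is orthogonal to itself and thus 0. So the
  moments span the dual space, and the coefficients of the combination are those of the representer
  \<open>r\<close>.\<close>

lemma poly_functional_riesz:
  fixes L :: "real poly \<Rightarrow> real"
  assumes L: "\<And>p q c. L (p + smult c q) = L p + c * L q" and ab: "a < b"
  shows "\<exists>r. degree r \<le> n \<and>
    (\<forall>p. degree p \<le> n \<longrightarrow> L p = integral {a..b} (\<lambda>x. poly p x * poly r x))"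
proof -
  have moments: "integral {a..b} (\<lambda>x. poly p x * poly r x) =
      (\<Sum>m\<le>n. coeff r m * integral {a..b} (\<lambda>x. poly p x * x ^ m))"
    if "degree r \<le> n" for p r :: "real poly"
  proof -
    have "integral {a..b} (\<lambda>x. poly p x * poly r x) =
        integral {a..b} (\<lambda>x. \<Sum>m\<le>n. coeff r m * (poly p x * x ^ m))"
    proof (rule integral_cong)
      fix x
      have "poly r x = (\<Sum>m\<le>n. coeff r m * x ^ m)"
        unfolding poly_altdef using that
        by (intro sum.mono_neutral_left) (auto simp: coeff_eq_0)
      then show "poly p x * poly r x = (\<Sum>m\<le>n. coeff r m * (poly p x * x ^ m))"
        by (simp add: sum_distrib_left mult.left_commute)
    qed
    also have "\<dots> = (\<Sum>m\<le>n. coeff r m * integral {a..b} (\<lambda>x. poly p x * x ^ m))"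
      by (subst integral_sum) (auto intro!: integrable_continuous_real continuous_intros)
    finally show ?thesis .
  qed
  have "\<exists>c. \<forall>p\<in>{p. degree p \<le> n}.
      L p = (\<Sum>m\<in>{..n}. c m * integral {a..b} (\<lambda>x. poly p x * x ^ m))"
  proof (rule functional_in_span)
    fix p q :: "real poly" and c :: real
    assume "p \<in> {p. degree p \<le> n}" "q \<in> {p. degree p \<le> n}"
    moreover have "integral {a..b} (\<lambda>x. poly (p + smult c q) x * x ^ m) =
       integral {a..b} (\<lambda>x. poly p x * x ^ m) + c * integral {a..b} (\<lambda>x. poly q x * x ^ m)" for m
      unfolding integral_mult_right[symmetric]
      by (subst integral_add[symmetric])
        (auto intro!: integrable_continuous_real continuous_intros simp: algebra_simps)
    ultimately show "\<exists>z\<in>{p. degree p \<le> n}.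
       (\<forall>m\<in>{..n}. integral {a..b} (\<lambda>x. poly z x * x ^ m) =
          integral {a..b} (\<lambda>x. poly p x * x ^ m) + c * integral {a..b} (\<lambda>x. poly q x * x ^ m)) \<and>
       L z = L p + c * L q"
      by (intro bexI[of _ "p + smult c q"])
        (auto simp: L intro: degree_add_le order_trans[OF degree_smult_le])
  next
    fix p :: "real poly" assume p: "p \<in> {p. degree p \<le> n}"
      "\<forall>m\<in>{..n}. integral {a..b} (\<lambda>x. poly p x * x ^ m) = 0"
    have "integral {a..b} (\<lambda>x. poly p x * poly p x) = 0"
      using moments[of p p] p by simp
    then have "\<forall>x\<in>{a..b}. poly p x * poly p x = 0"
      by (subst (asm) integral_eq_0_iff) (use ab in \<open>auto intro!: continuous_intros\<close>)
    then have "p = 0" using poly_eq_0_on_Icc[OF ab, of p] by simp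
    moreover have "L 0 = 0" using L[of 0 1 0] by simp
    ultimately show "L p = 0" by simp
  qed simp
  then obtain c where c: "\<And>p. degree p \<le> n \<Longrightarrow>
      L p = (\<Sum>m\<le>n. c m * integral {a..b} (\<lambda>x. poly p x * x ^ m))" by auto
  define r where "r = (\<Sum>m\<le>n. monom (c m) m)"
  have "degree r \<le> n" unfolding r_def
    by (intro degree_sum_le) (auto intro: order_trans[OF degree_monom_le])
  moreover have "coeff r m = c m" if "m \<le> n" for m
    using that by (simp add: r_def coeff_sum if_distrib sum.delta)
  ultimately show ?thesis using c moments by (intro exI[of _ r]) auto
qed

text \<open>As \<open>f t = 0\<close>, the difference quotient of the product is \<open>prod\<close>
  applied to the difference quotient of \<open>f\<close> and to \<open>u s\<close>, so continuity of
  \<open>u\<close> suffices.\<close>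

lemma has_real_derivative_bilinear_vanishing:
  fixes f :: "real \<Rightarrow> 'a::real_normed_vector" and u :: "real \<Rightarrow> 'b::real_normed_vector"
    and prod :: "'a \<Rightarrow> 'b \<Rightarrow> real"
  assumes "bounded_bilinear prod"
    and f: "(f has_vector_derivative f') (at t within S)" "f t = 0"
    and u: "continuous (at t within S) u"
  shows "((\<lambda>s. prod (f s) (u s)) has_real_derivative prod f' (u t)) (at t within S)"
proof -
  interpret bounded_bilinear prod by fact
  have "((\<lambda>s. (1 / norm (s - t)) *\<^sub>R (f s - (s - t) *\<^sub>R f')) \<longlongrightarrow> 0) (at t within S)"
    using f by (simp add: has_vector_derivative_def has_derivative_within)
  then have "((\<lambda>s. norm ((1 / norm (s - t)) *\<^sub>R (f s - (s - t) *\<^sub>R f'))) \<longlongrightarrow> 0) (at t within S)"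
    by (rule tendsto_norm_zero)
  then have "((\<lambda>s. norm (f s /\<^sub>R (s - t) - f')) \<longlongrightarrow> 0) (at t within S)"
  \<comment> \<open>One quotient divides by \<open>norm (s - t)\<close>, the other by
    \<open>s - t\<close>; they differ by a sign, which the outer norm removes.\<close>
  proof (rule Lim_transform_eventually)
    show "\<forall>\<^sub>F s in at t within S.
        norm ((1 / norm (s - t)) *\<^sub>R (f s - (s - t) *\<^sub>R f')) = norm (f s /\<^sub>R (s - t) - f')"
      unfolding eventually_at_filter
    proof (rule always_eventually, intro allI impI)
      fix s assume "s \<noteq> t"
      then have "f s /\<^sub>R (s - t) - f' = (1 / (s - t)) *\<^sub>R (f s - (s - t) *\<^sub>R f')"
        by (simp add: scaleR_diff_right divide_inverse)
      then show "norm ((1 / norm (s - t)) *\<^sub>R (f s - (s - t) *\<^sub>R f')) = norm (f s /\<^sub>R (s - t) - f')"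
        by simp
    qed
  qed
  then have "((\<lambda>s. f s /\<^sub>R (s - t)) \<longlongrightarrow> f') (at t within S)"
    by (rule LIM_zero_cancel[OF tendsto_norm_zero_cancel])
  then have "((\<lambda>s. prod (f s /\<^sub>R (s - t)) (u s)) \<longlongrightarrow> prod f' (u t)) (at t within S)"
    using u unfolding continuous_within by (rule tendsto)
  then show ?thesis
    unfolding has_field_derivative_iff
    by (simp add: f(2) zero_left scaleR_left divide_inverse mult.commute)
qed

section \<open>Entropy balance in space\<close>

lemma mesh_int_cong:
  "(\<And>i x. i < N \<Longrightarrow> x \<in> {X i..X (Suc i)} \<Longrightarrow> F i x = G i x) \<Longrightarrow> mesh_int N X F = mesh_int N X G"
  unfolding mesh_int_def by (intro sum.cong integral_cong) auto

lemma
  assumes "\<And>i. continuous_on UNIV (F i)" "\<And>i. continuous_on UNIV (G i)"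
  shows mesh_int_add: "mesh_int N X (\<lambda>i x. F i x + G i x) = mesh_int N X F + mesh_int N X G"
    and mesh_int_diff: "mesh_int N X (\<lambda>i x. F i x - G i x) = mesh_int N X F - mesh_int N X G"
proof -
  have "F i integrable_on {X i..X (Suc i)}" "G i integrable_on {X i..X (Suc i)}" for i
    using assms by (auto intro!: integrable_continuous_real intro: continuous_on_subset)
  then show "mesh_int N X (\<lambda>i x. F i x + G i x) = mesh_int N X F + mesh_int N X G"
    "mesh_int N X (\<lambda>i x. F i x - G i x) = mesh_int N X F - mesh_int N X G"
    by (simp_all add: mesh_int_def integral_add integral_diff sum.distrib sum_subtractf)
qed

lemma mesh_int_cmult: "mesh_int N X (\<lambda>i x. c * F i x) = c * mesh_int N X F"
  by (simp add: mesh_int_def sum_distrib_left)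

lemma mesh_int_sum:
  assumes "\<And>i j. j \<in> J \<Longrightarrow> continuous_on UNIV (F j i)" "finite J"
  shows "mesh_int N X (\<lambda>i x. \<Sum>j\<in>J. F j i x) = (\<Sum>j\<in>J. mesh_int N X (F j))"
proof -
  have "F j i integrable_on {X i..X (Suc i)}" if "j \<in> J" for i j
    using assms that by (auto intro!: integrable_continuous_real intro: continuous_on_subset)
  then show ?thesis unfolding mesh_int_def
    by (subst sum.swap) (simp add: integral_sum[OF assms(2)])
qed

lemma val_nth: "val a i x $ j = poly (a i $ j) x"
  and dx_nth: "dx a i x $ j = poly (pderiv (a i $ j)) x"
  by (simp_all add: val_def dx_def)

lemma continuous_on_val [continuous_intros]: "continuous_on S (val a i)"
  and continuous_on_dx [continuous_intros]: "continuous_on S (dx a i)"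
  unfolding val_def[abs_def] dx_def[abs_def] by (intro continuous_intros)+

lemma val_smul: "val (smul v a) i x = poly (v i) x *\<^sub>R val a i x"
  by (simp add: val_def smul_def vec_eq_iff)

lemma dx_smul: "dx (smul v a) i x = poly (pderiv (v i)) x *\<^sub>R val a i x + poly (v i) x *\<^sub>R dx a i x"
  by (simp add: val_def dx_def smul_def vec_eq_iff pderiv_mult)

lemma val_add: "val (\<lambda>i. a i + b i) i x = val a i x + val b i x"
  and dx_add: "dx (\<lambda>i. a i + b i) i x = dx a i x + dx b i x"
  by (simp_all add: val_def dx_def vec_eq_iff pderiv_add)

lemma DGvec_iff: "a \<in> DGvec N k \<longleftrightarrow> (\<forall>i<N. \<forall>j. degree (a i $ j) \<le> k)"
  by (auto simp: DGvec_def DG_def)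

lemma DGvec_add: "a \<in> DGvec N k \<Longrightarrow> b \<in> DGvec N k \<Longrightarrow> (\<lambda>i. a i + b i) \<in> DGvec N k"
  and DGvec_diff: "a \<in> DGvec N k \<Longrightarrow> b \<in> DGvec N k \<Longrightarrow> (\<lambda>i. a i - b i) \<in> DGvec N k"
  by (simp_all add: DGvec_iff degree_add_le degree_diff_le)

lemma DGvec_pderiv: "a \<in> DGvec N k \<Longrightarrow> (\<lambda>i. \<chi> j. pderiv (a i $ j)) \<in> DGvec N k"
  by (auto simp: DGvec_iff degree_pderiv intro: le_trans[OF diff_le_self])

lemma val_pderiv: "val (\<lambda>i. \<chi> j. pderiv (a i $ j)) i x = dx a i x"
  by (simp add: val_def dx_def)

lemma mesh_int_inner:
  fixes F G :: "nat \<Rightarrow> real \<Rightarrow> real^'K::finite"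
  assumes "\<And>i. continuous_on UNIV (F i)" "\<And>i. continuous_on UNIV (G i)"
  shows "mesh_int N X (\<lambda>i x. F i x \<bullet> G i x) = (\<Sum>j\<in>UNIV. mesh_int N X (\<lambda>i x. F i x $ j * G i x $ j))"
  unfolding inner_vec_def inner_real_def
  by (rule mesh_int_sum) (auto intro!: continuous_intros assms)

text \<open>The stochastic basis enters the analysis through these three properties of
  \<open>P\<close>, which make \<open>(P a *v b) \<bullet> c\<close> a totally symmetric trilinear
  form. \<open>galerkin_mesh_pc_matrix\<close> derives them from the triple products.\<close>

locale galerkin_mesh =
  fixes P :: "real^'K \<Rightarrow> real^'K^'K::finite" and N :: nat and X :: "nat \<Rightarrow> real"
  assumes linear_P: "linear P"
    and P_commute: "P a *v b = P b *v a"
    and P_symmetric: "transpose (P a) = P a"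
    and mesh: "periodic_mesh N X"
begin

lemma bounded_bilinear_P: "bounded_bilinear (\<lambda>a b. P a *v b)"
proof -
  have "bilinear (\<lambda>a b. P a *v b)"
    unfolding bilinear_def
    by (auto intro!: linearI simp: matrix_vector_right_distrib matrix_vector_mult_add_rdistrib
        linear_add[OF linear_P] linear_cmul[OF linear_P] scaleR_matrix_vector_assoc[symmetric]
        matrix_vector_mult_scaleR)
  then show ?thesis using bilinear_conv_bounded_bilinear by blast
qed

sublocale P: bounded_bilinear "\<lambda>a b. P a *v b"
  by (rule bounded_bilinear_P)

lemmas continuous_on_P [continuous_intros] = P.continuous_on

lemma P_inner: "(P a *v b) \<bullet> c = b \<bullet> (P a *v c)"
  using dot_lmul_matrix[of b "P a" c] transpose_matrix_vector[of "P a" b] by (simp add: P_symmetric)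

lemma P_inner_self_adjoint: "(P a *v b) \<bullet> c = (P a *v c) \<bullet> b"
  using P_inner[of a b c] inner_commute[of b] by simp

text \<open>\<open>P_commute\<close> swaps the first two slots, self-adjointness the last two; these
  transpositions generate all permutations.\<close>

lemma P_inner_rotate: "(P a *v b) \<bullet> c = (P b *v c) \<bullet> a"
  using P_commute[of a b] P_inner_self_adjoint[of b a c] by simp

text \<open>The scheme tests each component with a scalar function. Testing component
  \<open>j\<close> with the \<open>j\<close>-th component of one vector field and summing over
  \<open>j\<close> gives the inner-product form; the other two equations are treated alike.\<close>

lemma mass_eq_inner:
  assumes m: "mass_eq N X k fq ht q" and e: "e \<in> DGvec N k"
  shows "mesh_int N X (\<lambda>i x. val ht i x \<bullet> val e i x) =
    mesh_int N X (\<lambda>i x. val q i x \<bullet> dx e i x) + (\<Sum>i<N. fq i \<bullet> jump N X (val e) i)"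
proof -
  have "mesh_int N X (\<lambda>i x. val ht i x $ j * val e i x $ j)
     - mesh_int N X (\<lambda>i x. val q i x $ j * dx e i x $ j)
     - (\<Sum>i<N. fq i $ j * jump N X (val e) i $ j) = 0" for j
    using m[unfolded mass_eq_def, rule_format, of "\<lambda>i. e i $ j" j] e
    by (simp add: DGvec_def val_nth dx_nth jump_def trace_plus_def trace_minus_def)
  then have "(\<Sum>j\<in>UNIV. mesh_int N X (\<lambda>i x. val ht i x $ j * val e i x $ j)
     - mesh_int N X (\<lambda>i x. val q i x $ j * dx e i x $ j)
     - (\<Sum>i<N. fq i $ j * jump N X (val e) i $ j)) = 0" by simp
  moreover have "(\<Sum>j\<in>UNIV. \<Sum>i<N. fq i $ j * jump N X (val e) i $ j) = (\<Sum>i<N. fq i \<bullet> jump N X (val e) i)"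
    by (subst sum.swap) (simp add: inner_vec_def)
  ultimately show ?thesis
    by (simp add: mesh_int_inner continuous_intros sum_subtractf)
qed

lemma velocity_eq_inner:
  assumes m: "velocity_eq P N X k h q u" and w: "w \<in> DGvec N k"
  shows "mesh_int N X (\<lambda>i x. (P (val h i x) *v val u i x) \<bullet> val w i x) =
    mesh_int N X (\<lambda>i x. val q i x \<bullet> val w i x)"
proof -
  have "mesh_int N X (\<lambda>i x. (P (val h i x) *v val u i x - val q i x) $ j * val w i x $ j) = 0" for j
    using m[unfolded velocity_eq_def, rule_format, of "\<lambda>i. w i $ j" j] w
    by (simp add: DGvec_def val_nth)
  then have "mesh_int N X (\<lambda>i x. (P (val h i x) *v val u i x - val q i x) \<bullet> val w i x) = 0"
    by (subst mesh_int_inner) (auto intro!: continuous_intros)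
  then show ?thesis
    by (simp add: inner_diff_left mesh_int_diff continuous_intros)
qed

text \<open>Expanding the derivative of the product \<open>v u\<close> in the correction term
  returns half of the flux term. What remains is a difference that is skew in \<open>u\<close> and
  \<open>v\<close> and so vanishes for \<open>v = u\<close>. Averages and jumps stay on products,
  because the scheme takes traces of \<open>v h\<close> and \<open>v u\<close>.\<close>

lemma momentum_eq_inner:
  assumes m: "momentum_eq P N X k g B fq fqu ht qt h q u" and v: "v \<in> DGvec N k"
  shows "mesh_int N X (\<lambda>i x. val qt i x \<bullet> val v i x) =
      1/2 * mesh_int N X (\<lambda>i x. (P (val q i x) *v val u i x) \<bullet> dx v i x)
    - 1/2 * mesh_int N X (\<lambda>i x. (P (val q i x) *v dx u i x) \<bullet> val v i x)
    + (\<Sum>i<N. fqu i \<bullet> jump N X (val v) i)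
    - g * mesh_int N X (\<lambda>i x. (P (dx h i x + dx B i x) *v val h i x) \<bullet> val v i x)
    - g * (\<Sum>i<N. avg N X (\<lambda>i' x. (P (jump N X (\<lambda>i x. val h i x + val B i x) i) *v val h i' x) \<bullet> val v i' x) i)
    + 1/2 * mesh_int N X (\<lambda>i x. (P (val ht i x) *v val u i x) \<bullet> val v i x)
    - 1/2 * (\<Sum>i<N. jump N X (\<lambda>i' x. (P (fq i) *v val u i' x) \<bullet> val v i' x) i)"
proof -
  let ?eta = "\<lambda>i x. val h i x + val B i x"
  have "mesh_int N X (\<lambda>i x. val qt i x $ j * val v i x $ j)
     - mesh_int N X (\<lambda>i x. (P (val q i x) *v val u i x) $ j * dx v i x $ j)
     - (\<Sum>i<N. fqu i $ j * jump N X (val v) i $ j)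
     + g * mesh_int N X (\<lambda>i x. (P (dx h i x + dx B i x) *v val h i x) $ j * val v i x $ j)
     + g * (\<Sum>i<N. avg N X (\<lambda>i' x. (P (jump N X ?eta i) *v val h i' x) $ j * val v i' x $ j) i)
     - 1/2 * mesh_int N X (\<lambda>i x. (P (val ht i x) *v val u i x) $ j * val v i x $ j)
     + 1/2 * (mesh_int N X (\<lambda>i x. (P (val q i x) *v dx u i x) $ j * val v i x $ j)
           + mesh_int N X (\<lambda>i x. (P (val q i x) *v val u i x) $ j * dx v i x $ j))
     + 1/2 * (\<Sum>i<N. jump N X (\<lambda>i' x. (P (fq i) *v val u i' x) $ j * val v i' x $ j) i) = 0" (is "?E j = 0") for j
  proof -
    have 1: "mesh_int N X (\<lambda>i x. g * (P (dx h i x + dx B i x) *v val (smul (\<lambda>i. v i $ j) h) i x) $ j) =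
       g * mesh_int N X (\<lambda>i x. (P (dx h i x + dx B i x) *v val h i x) $ j * val v i x $ j)"
      by (simp add: val_smul val_nth mesh_int_cmult matrix_vector_mult_scaleR mult.commute)
    have 2: "mesh_int N X (\<lambda>i x. 1/2 * (P (val ht i x) *v val u i x) $ j * poly (v i $ j) x) =
       1/2 * mesh_int N X (\<lambda>i x. (P (val ht i x) *v val u i x) $ j * val v i x $ j)"
      unfolding mesh_int_cmult[symmetric] by (simp add: val_nth)
    have 3: "mesh_int N X (\<lambda>i x. 1/2 * (P (val q i x) *v dx (smul (\<lambda>i. v i $ j) u) i x) $ j) =
       1/2 * (mesh_int N X (\<lambda>i x. (P (val q i x) *v dx u i x) $ j * val v i x $ j)
           + mesh_int N X (\<lambda>i x. (P (val q i x) *v val u i x) $ j * dx v i x $ j))"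
      unfolding mesh_int_cmult
      by (subst mesh_int_add[symmetric]) (auto intro!: continuous_intros mesh_int_cong
          simp: dx_smul val_nth dx_nth matrix_vector_mult_scaleR matrix_vector_right_distrib algebra_simps)
    have 4: "(\<Sum>i<N. g * (P (jump N X ?eta i) *v avg N X (val (smul (\<lambda>i. v i $ j) h)) i) $ j) =
      g * (\<Sum>i<N. avg N X (\<lambda>i' x. (P (jump N X ?eta i) *v val h i' x) $ j * val v i' x $ j) i)"
      unfolding sum_distrib_left
      by (rule sum.cong) (simp_all add: avg_def trace_plus_def trace_minus_def val_smul val_nth
          matrix_vector_mult_scaleR matrix_vector_right_distrib algebra_simps)
    have 5: "(\<Sum>i<N. 1/2 * (P (fq i) *v jump N X (val (smul (\<lambda>i. v i $ j) u)) i) $ j) =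
       1/2 * (\<Sum>i<N. jump N X (\<lambda>i' x. (P (fq i) *v val u i' x) $ j * val v i' x $ j) i)"
      unfolding sum_distrib_left
      by (rule sum.cong) (simp_all add: jump_def trace_plus_def trace_minus_def val_smul val_nth
          matrix_vector_mult_scaleR matrix_vector_mult_diff_distrib algebra_simps)
    have 6: "(\<Sum>i<N. fqu i $ j * jump N X (\<lambda>i x. poly (v i $ j) x) i) = (\<Sum>i<N. fqu i $ j * jump N X (val v) i $ j)"
      by (simp add: jump_def trace_plus_def trace_minus_def val_nth)
    have "(\<lambda>i. v i $ j) \<in> DG N k" using v by (simp add: DGvec_def)
    from m[unfolded momentum_eq_def, rule_format, OF this, of j, unfolded 1 2 3 4 5 6]
    show ?thesis by (simp only: val_nth dx_nth)
  qed
  then have summed: "(\<Sum>j\<in>UNIV. ?E j) = 0" by (intro sum.neutral) blast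
  have avg_sum: "(\<Sum>j\<in>UNIV. \<Sum>i<N. avg N X (\<lambda>i' x. F i i' x $ j * G i i' x $ j) i) =
     (\<Sum>i<N. avg N X (\<lambda>i' x. F i i' x \<bullet> G i i' x) i)" for F G :: "nat \<Rightarrow> nat \<Rightarrow> real \<Rightarrow> real^'K"
    by (subst sum.swap) (simp add: avg_def trace_plus_def trace_minus_def inner_vec_def
        sum.distrib sum_divide_distrib[symmetric])
  have jump_sum: "(\<Sum>j\<in>UNIV. \<Sum>i<N. jump N X (\<lambda>i' x. F i i' x $ j * G i i' x $ j) i) =
     (\<Sum>i<N. jump N X (\<lambda>i' x. F i i' x \<bullet> G i i' x) i)" for F G :: "nat \<Rightarrow> nat \<Rightarrow> real \<Rightarrow> real^'K"
    by (subst sum.swap) (simp add: jump_def trace_plus_def trace_minus_def inner_vec_def sum_subtractf)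
  have fqu: "(\<Sum>j\<in>UNIV. \<Sum>i<N. fqu i $ j * jump N X (val v) i $ j) = (\<Sum>i<N. fqu i \<bullet> jump N X (val v) i)"
    by (subst sum.swap) (simp add: inner_vec_def)
  from summed show ?thesis
    by (simp add: mesh_int_inner continuous_intros sum_subtractf sum.distrib
        sum_distrib_left[symmetric] sum_divide_distrib[symmetric] avg_sum jump_sum fqu) (simp add: field_simps)
qed

text \<open>The formal time derivative of the entropy with \<open>u_t\<close> eliminated:
  differentiating \<open>q = P h u\<close> and pairing with \<open>u\<close> gives
  \<open>q . u_t = q_t . u - P h_t u . u\<close>, and half the sum with \<open>q_t . u\<close> is
  the kinetic part.\<close>

definition entropy_rate where
  "entropy_rate g B ht qt h u = mesh_int N X (\<lambda>i x.
     g * (val ht i x \<bullet> (val h i x + val B i x)) + val qt i x \<bullet> val u i x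
     - 1/2 * ((P (val ht i x) *v val u i x) \<bullet> val u i x))"

lemma entropy_rate_interfaces:
  assumes DG: "h \<in> DGvec N k" "u \<in> DGvec N k" "B \<in> DGvec N k"
    and mass: "mass_eq N X k fq ht q"
    and momentum: "momentum_eq P N X k g B fq fqu ht qt h q u"
    and velocity: "velocity_eq P N X k h q u"
  shows "entropy_rate g B ht qt h u = (\<Sum>i<N.
      g * ((fq i - avg N X (\<lambda>i x. P (val h i x) *v val u i x) i) \<bullet> jump N X (\<lambda>i x. val h i x + val B i x) i)
      + (fqu i - P (fq i) *v avg N X (val u) i) \<bullet> jump N X (val u) i)"
proof -
  let ?eta = "\<lambda>i. h i + B i"
  have eta: "?eta \<in> DGvec N k" using DG DGvec_add by blast
  have val_eta: "val ?eta = (\<lambda>i x. val h i x + val B i x)" by (simp add: fun_eq_iff val_add)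
  have M: "mesh_int N X (\<lambda>i x. val ht i x \<bullet> (val h i x + val B i x)) =
      mesh_int N X (\<lambda>i x. val q i x \<bullet> dx ?eta i x) + (\<Sum>i<N. fq i \<bullet> jump N X (\<lambda>i x. val h i x + val B i x) i)"
    using mass_eq_inner[OF mass eta] by (simp only: val_eta)
  have V: "mesh_int N X (\<lambda>i x. (P (val h i x) *v val u i x) \<bullet> dx ?eta i x) =
    mesh_int N X (\<lambda>i x. val q i x \<bullet> dx ?eta i x)"
    using velocity_eq_inner[OF velocity DGvec_pderiv[OF eta]] by (simp only: val_pderiv)
  \<comment> \<open>The hydrostatic volume term, once rotated, is the left side of \<open>V\<close>.
    So it cancels the volume term of the mass equation, both carrying the factor
    \<open>g\<close>.\<close>
  have V': "mesh_int N X (\<lambda>i x. (P (dx h i x + dx B i x) *v val h i x) \<bullet> val u i x) =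
     mesh_int N X (\<lambda>i x. val q i x \<bullet> dx ?eta i x)"
    by (subst V[symmetric], unfold dx_add, intro mesh_int_cong, rule P_inner_rotate)
  have Q: "mesh_int N X (\<lambda>i x. (P (val q i x) *v val u i x) \<bullet> dx u i x) =
     mesh_int N X (\<lambda>i x. (P (val q i x) *v dx u i x) \<bullet> val u i x)"
    by (intro mesh_int_cong) (rule P_inner_self_adjoint)
  \<comment> \<open>A symmetric quadratic form obeys \<open>[b^2] = 2 {b} [b]\<close>; this 2
    absorbs the factor 1/2 of the last interface sum.\<close>
  have J: "jump N X (\<lambda>i' x. (P a *v val u i' x) \<bullet> val u i' x) i =
      2 * ((P a *v avg N X (val u) i) \<bullet> jump N X (val u) i)" for a i
  proof -
    have "(P a *v b) \<bullet> b - (P a *v c) \<bullet> c = 2 * ((P a *v ((1/2) *\<^sub>R (b + c))) \<bullet> (b - c))" for b c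
      using P_inner_self_adjoint[of a b c]
      by (simp add: matrix_vector_mult_scaleR matrix_vector_right_distrib inner_add_left inner_diff_right field_simps)
    then show ?thesis by (simp add: jump_def avg_def trace_plus_def trace_minus_def)
  qed
  \<comment> \<open>Rotation moves \<open>z\<close>, later the jump of \<open>h + B\<close>, out of
    \<open>P\<close> and exposes the central average to be compared with \<open>fq\<close>.\<close>
  have A: "avg N X (\<lambda>i' x. (P z *v val h i' x) \<bullet> val u i' x) i =
      avg N X (\<lambda>i x. P (val h i x) *v val u i x) i \<bullet> z" for z i
    by (simp add: avg_def trace_plus_def trace_minus_def inner_add_left P_inner_rotate[of z])
  have "entropy_rate g B ht qt h u =
      g * mesh_int N X (\<lambda>i x. val ht i x \<bullet> (val h i x + val B i x)) + mesh_int N X (\<lambda>i x. val qt i x \<bullet> val u i x)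
      - 1/2 * mesh_int N X (\<lambda>i x. (P (val ht i x) *v val u i x) \<bullet> val u i x)"
    unfolding entropy_rate_def mesh_int_cmult[symmetric]
    by (simp only: mesh_int_add mesh_int_diff continuous_intros)
  also have "\<dots> = (\<Sum>i<N. g * (fq i \<bullet> jump N X (\<lambda>i x. val h i x + val B i x) i)) +
       (\<Sum>i<N. fqu i \<bullet> jump N X (val u) i)
    - (\<Sum>i<N. g * (avg N X (\<lambda>i x. P (val h i x) *v val u i x) i \<bullet> jump N X (\<lambda>i x. val h i x + val B i x) i))
    - (\<Sum>i<N. (P (fq i) *v avg N X (val u) i) \<bullet> jump N X (val u) i)"
    unfolding momentum_eq_inner[OF momentum DG(2)] M V' Q J A
    by (simp add: algebra_simps sum_distrib_left)
  finally show ?thesis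
    by (simp add: sum.distrib[symmetric] sum_subtractf[symmetric] inner_diff_left algebra_simps)
qed

lemma entropy_rate_central:
  assumes "h \<in> DGvec N k" "u \<in> DGvec N k" "B \<in> DGvec N k"
    and "mass_eq N X k (central_fq P N X h u) ht q"
    and "momentum_eq P N X k g B (central_fq P N X h u) (central_fqu P N X h u) ht qt h q u"
    and "velocity_eq P N X k h q u"
  shows "entropy_rate g B ht qt h u = 0"
  unfolding entropy_rate_interfaces[OF assms] by (simp add: central_fq_def central_fqu_def)

lemma entropy_rate_lf:
  assumes "h \<in> DGvec N k" "u \<in> DGvec N k" "B \<in> DGvec N k"
    and "mass_eq N X k (lf_fq P N X B \<alpha> h u) ht q"
    and "momentum_eq P N X k g B (lf_fq P N X B \<alpha> h u) (lf_fqu P N X B \<alpha> h u) ht qt h q u"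
    and "velocity_eq P N X k h q u"
    and "0 \<le> \<alpha>" "0 \<le> g"
    and psd: "\<And>i. i < N \<Longrightarrow> pos_semidef (P (avg N X (\<lambda>i x. val h i x + val B i x) i))"
  shows "entropy_rate g B ht qt h u \<le> 0"
  unfolding entropy_rate_interfaces[OF assms(1-6)]
proof (rule sum_nonpos)
  fix i assume "i \<in> {..<N}"
  let ?eta = "\<lambda>i x. val h i x + val B i x" and ?Pu = "\<lambda>i x. P (val h i x + val B i x) *v val u i x"
  \<comment> \<open>The part \<open>P [h + B] {u}\<close> is also what the penalty in
    \<open>f_q\<close> contributes to \<open>P f_q {u}\<close>, so it drops out of
    \<open>f_qu - P f_q {u}\<close>. Only the part with \<open>P {h + B}\<close> is left, to which
    \<open>psd\<close> applies.\<close>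
  have product_rule: "jump N X ?Pu i = P (jump N X ?eta i) *v avg N X (val u) i + P (avg N X ?eta i) *v jump N X (val u) i"
  proof -
    have "P a *v b - P c *v d = P (a - c) *v ((1/2) *\<^sub>R (b + d)) + P ((1/2) *\<^sub>R (a + c)) *v (b - d)" for a b c d
      by (simp add: P.add_left P.add_right P.diff_left P.diff_right P.scaleR_left P.scaleR_right
          vec_eq_iff field_simps)
    then show ?thesis by (simp add: jump_def avg_def trace_plus_def trace_minus_def)
  qed
  have "0 \<le> (P (avg N X ?eta i) *v jump N X (val u) i) \<bullet> jump N X (val u) i"
    using psd[of i] \<open>i \<in> {..<N}\<close> by (simp add: pos_semidef_def inner_commute)
  then have "0 \<le> \<alpha> / 2 * (g * (jump N X ?eta i \<bullet> jump N X ?eta i)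
      + (P (avg N X ?eta i) *v jump N X (val u) i) \<bullet> jump N X (val u) i)"
    using assms(7,8) by simp
  also have "\<dots> = - (g * ((lf_fq P N X B \<alpha> h u i - avg N X (\<lambda>i x. P (val h i x) *v val u i x) i) \<bullet> jump N X ?eta i)
      + (lf_fqu P N X B \<alpha> h u i - P (lf_fq P N X B \<alpha> h u i) *v avg N X (val u) i) \<bullet> jump N X (val u) i)"
    unfolding lf_fq_def lf_fqu_def product_rule
    by (simp add: P.diff_left P.scaleR_left inner_diff_left inner_add_left algebra_simps)
  finally show "g * ((lf_fq P N X B \<alpha> h u i - avg N X (\<lambda>i x. P (val h i x) *v val u i x) i) \<bullet> jump N X ?eta i)
      + (lf_fqu P N X B \<alpha> h u i - P (lf_fq P N X B \<alpha> h u i) *v avg N X (val u) i) \<bullet> jump N X (val u) i \<le> 0"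
    by simp
qed

end

section \<open>Entropy balance in time\<close>

text \<open>Stated for functions, since integrands are composed of \<open>val\<close>, inner
  products and \<open>P\<close>; the degree bound decides whether a quadrature is exact.\<close>

definition polynomial_upto :: "nat \<Rightarrow> (real \<Rightarrow> real) \<Rightarrow> bool" where
  "polynomial_upto n f \<longleftrightarrow> (\<exists>p. degree p \<le> n \<and> f = poly p)"

lemma polynomial_upto_mono: "polynomial_upto m f \<Longrightarrow> m \<le> n \<Longrightarrow> polynomial_upto n f"
  unfolding polynomial_upto_def using le_trans by blast

lemma polynomial_upto_poly: "degree p \<le> n \<Longrightarrow> polynomial_upto n (poly p)"
  unfolding polynomial_upto_def by blast

lemma polynomial_upto_const: "polynomial_upto n (\<lambda>x. c)"
  unfolding polynomial_upto_def by (rule exI[of _ "[:c:]"]) auto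

lemma
  assumes "polynomial_upto n f" "polynomial_upto n g"
  shows polynomial_upto_add: "polynomial_upto n (\<lambda>x. f x + g x)"
    and polynomial_upto_diff: "polynomial_upto n (\<lambda>x. f x - g x)"
proof -
  obtain p q where "degree p \<le> n" "f = poly p" "degree q \<le> n" "g = poly q"
    using assms by (auto simp: polynomial_upto_def)
  then show "polynomial_upto n (\<lambda>x. f x + g x)" "polynomial_upto n (\<lambda>x. f x - g x)"
    using polynomial_upto_poly[OF degree_add_le[of p n q]] polynomial_upto_poly[OF degree_diff_le[of p n q]]
    by (simp_all add: poly_add[abs_def] poly_diff[abs_def])
qed

lemma polynomial_upto_mult:
  assumes "polynomial_upto n f" "polynomial_upto m g"
  shows "polynomial_upto (n + m) (\<lambda>x. f x * g x)"
proof -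
  obtain p q where "degree p \<le> n" "f = poly p" "degree q \<le> m" "g = poly q"
    using assms by (auto simp: polynomial_upto_def)
  then show ?thesis
    using degree_mult_le[of p q] unfolding polynomial_upto_def
    by (intro exI[of _ "p * q"]) auto
qed

lemma polynomial_upto_cmult: "polynomial_upto n f \<Longrightarrow> polynomial_upto n (\<lambda>x. c * f x)"
  using polynomial_upto_mult[OF polynomial_upto_const[of 0 c]] by simp

lemma polynomial_upto_sum:
  "(\<And>j. j \<in> J \<Longrightarrow> polynomial_upto n (f j)) \<Longrightarrow> polynomial_upto n (\<lambda>x. \<Sum>j\<in>J. f j x)"
  by (induction J rule: infinite_finite_induct)
    (auto intro: polynomial_upto_add polynomial_upto_const)

lemma polynomial_upto_inner:
  fixes F G :: "real \<Rightarrow> real^'K::finite"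
  assumes "\<And>j. polynomial_upto n (\<lambda>x. F x $ j)" "\<And>j. polynomial_upto m (\<lambda>x. G x $ j)"
  shows "polynomial_upto (n + m) (\<lambda>x. F x \<bullet> G x)"
  unfolding inner_vec_def inner_real_def by (intro polynomial_upto_sum polynomial_upto_mult assms)

lemma polynomial_upto_val: "a \<in> DGvec N k \<Longrightarrow> i < N \<Longrightarrow> polynomial_upto k (\<lambda>x. val a i x $ j)"
  unfolding val_nth by (rule polynomial_upto_poly) (auto simp: DGvec_iff)

text \<open>Any \<open>Suc n\<close> distinct nodes in an element admit weights exact up to degree
  \<open>n\<close>. A time-dependent integral thus becomes a finite sum of nodal values, to which
  pointwise time derivatives apply without differentiation under the integral.\<close>

lemma mesh_quadrature:
  assumes "periodic_mesh N X"
  shows "\<exists>S w. (\<forall>i<N. finite (S i) \<and> S i \<subseteq> {X i..X (Suc i)} \<and> card (S i) = Suc n) \<and>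
    (\<forall>F. (\<forall>i<N. polynomial_upto n (F i)) \<longrightarrow> mesh_int N X F = (\<Sum>i<N. \<Sum>s\<in>S i. w i s * F i s))"
proof -
  have "\<exists>S w. finite S \<and> S \<subseteq> {X i..X (Suc i)} \<and> card S = Suc n \<and>
     (\<forall>p. degree p \<le> n \<longrightarrow> integral {X i..X (Suc i)} (poly p) = (\<Sum>s\<in>S. w s * poly p s))" if "i < N" for i
  proof -
    have "infinite {X i..X (Suc i)}" using assms that by (simp add: periodic_mesh_def infinite_Icc)
    then obtain S where S: "finite S" "S \<subseteq> {X i..X (Suc i)}" "card S = Suc n"
      using infinite_arbitrarily_large by metis
    have "\<exists>w. \<forall>p. degree p \<le> n \<longrightarrow> integral {X i..X (Suc i)} (poly p) = (\<Sum>s\<in>S. w s * poly p s)"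
    proof (rule poly_functional_nodes)
      fix p q :: "real poly" and c :: real
      have "poly r integrable_on {X i..X (Suc i)}" for r :: "real poly"
        by (intro integrable_continuous_real continuous_on_poly continuous_on_id)
      moreover have "poly (p + smult c q) = (\<lambda>x. poly p x + c * poly q x)" by auto
      ultimately show "integral {X i..X (Suc i)} (poly (p + smult c q)) =
          integral {X i..X (Suc i)} (poly p) + c * integral {X i..X (Suc i)} (poly q)"
        by (simp add: integral_add integrable_on_mult_right)
    qed (use S in auto)
    then show ?thesis using S by blast
  qed
  then obtain S w where Sw: "\<And>i. i < N \<Longrightarrow> finite (S i) \<and> S i \<subseteq> {X i..X (Suc i)} \<and> card (S i) = Suc n \<and>
     (\<forall>p. degree p \<le> n \<longrightarrow> integral {X i..X (Suc i)} (poly p) = (\<Sum>s\<in>S i. w i s * poly p s))"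
    by metis
  moreover have "mesh_int N X F = (\<Sum>i<N. \<Sum>s\<in>S i. w i s * F i s)"
    if "\<forall>i<N. polynomial_upto n (F i)" for F
    unfolding mesh_int_def
  proof (rule sum.cong[OF refl])
    fix i assume "i \<in> {..<N}"
    then show "integral {X i..X (Suc i)} (F i) = (\<Sum>s\<in>S i. w i s * F i s)"
      using that Sw[of i] by (auto simp: polynomial_upto_def)
  qed
  ultimately show ?thesis by blast
qed

context galerkin_mesh
begin

text \<open>In the coordinate basis each component of \<open>P a *v b\<close> is a bilinear form
  with constant coefficients, so degrees add.\<close>

lemma polynomial_upto_P:
  assumes "\<And>j. polynomial_upto n (\<lambda>x. F x $ j)" "\<And>j. polynomial_upto m (\<lambda>x. G x $ j)"
  shows "polynomial_upto (n + m) (\<lambda>x. (P (F x) *v G x) $ j)"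
proof -
  have expand: "(\<Sum>l\<in>UNIV. a $ l *\<^sub>R axis l 1) = a" for a :: "real^'K"
    using basis_expansion[of a] by (simp add: scalar_mult_eq_scaleR)
  define c where "c l m = (P (axis l 1) *v axis m 1) $ j" for l m
  have "(P a *v b) $ j = (\<Sum>m\<in>UNIV. \<Sum>l\<in>UNIV. c l m * (b $ m * a $ l))" for a b
  proof -
    have "P a *v b = P (\<Sum>l\<in>UNIV. a $ l *\<^sub>R axis l 1) *v (\<Sum>m\<in>UNIV. b $ m *\<^sub>R axis m 1)"
      by (simp only: expand)
    also have "\<dots> = (\<Sum>m\<in>UNIV. \<Sum>l\<in>UNIV. (b $ m * a $ l) *\<^sub>R (P (axis l 1) *v axis m 1))"
      by (simp only: P.sum_left P.sum_right P.scaleR_left P.scaleR_right scaleR_sum_right scaleR_scaleR)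
    finally show ?thesis by (simp add: c_def mult.commute)
  qed
  then show ?thesis
    unfolding add.commute[of n]
    by (simp only:) (intro polynomial_upto_sum polynomial_upto_cmult polynomial_upto_mult assms)
qed

text \<open>The velocity is merely continuous in time. The weak relation between discharge and velocity
  and the symmetry of \<open>P\<close> turn the increment of the kinetic energy into a sum of increments of
  \<open>q\<close> and \<open>h\<close>, each paired with a continuous factor.\<close>

lemma entropy_has_real_derivative:
  assumes t: "t \<in> {0..T}" and B: "B \<in> DGvec N k"
    and DG: "\<And>s. s \<in> {0..T} \<Longrightarrow> h s \<in> DGvec N k \<and> q s \<in> DGvec N k \<and> u s \<in> DGvec N k"
    and DGt: "ht t \<in> DGvec N k" "qt t \<in> DGvec N k"
    and ht: "has_time_deriv N X T h ht" and qt: "has_time_deriv N X T q qt"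
    and u: "\<And>i x. i < N \<Longrightarrow> x \<in> {X i..X (Suc i)} \<Longrightarrow> continuous_on {0..T} (\<lambda>t. val (u t) i x)"
    and vel: "\<And>s. s \<in> {0..T} \<Longrightarrow> velocity_eq P N X k (h s) (q s) (u s)"
  shows "((\<lambda>s. entropy N X g B (h s) (q s) (u s)) has_real_derivative
      entropy_rate g B (ht t) (qt t) (h t) (u t)) (at t within {0..T})"
proof -
  \<comment> \<open>The highest product is \<open>(P h u) . w\<close> with three fields of degree
    \<open>k\<close>, whence \<open>3 * k\<close>.\<close>
  obtain S w where S: "\<And>i x. i < N \<Longrightarrow> x \<in> S i \<Longrightarrow> x \<in> {X i..X (Suc i)}"
    and quad: "\<And>F. (\<And>i. i < N \<Longrightarrow> polynomial_upto (3 * k) (F i)) \<Longrightarrow>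
        mesh_int N X F = (\<Sum>i<N. \<Sum>s\<in>S i. w i s * F i s)"
    using mesh_quadrature[OF mesh, of "3 * k"] by blast
  \<comment> \<open>The quadrature sum is linear on arbitrary integrands; exactness matters only
    when passing between \<open>Q\<close> and \<open>mesh_int\<close>.\<close>
  define Q where "Q F = (\<Sum>i<N. \<Sum>x\<in>S i. w i x * F i x)" for F
  have Q_add: "Q (\<lambda>i x. F i x + G i x) = Q F + Q G"
    and Q_diff: "Q (\<lambda>i x. F i x - G i x) = Q F - Q G"
    and Q_cmult: "Q (\<lambda>i x. c * F i x) = c * Q F" for F G c
    by (simp_all add: Q_def sum.distrib sum_subtractf algebra_simps sum_distrib_left)
  have pinner: "polynomial_upto (3 * k) (\<lambda>x. val a i x \<bullet> val b i x)"
    if "a \<in> DGvec N k" "b \<in> DGvec N k" "i < N" for a b :: "'K dgvec" and i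
    using polynomial_upto_inner[OF polynomial_upto_val polynomial_upto_val, OF that(1,3) that(2,3)]
    by (rule polynomial_upto_mono) simp
  have pP: "polynomial_upto (3 * k) (\<lambda>x. (P (val a i x) *v val b i x) \<bullet> val c i x)"
    if "a \<in> DGvec N k" "b \<in> DGvec N k" "c \<in> DGvec N k" "i < N" for a b c i
    using polynomial_upto_inner[OF polynomial_upto_P[OF polynomial_upto_val polynomial_upto_val]
        polynomial_upto_val, OF that(1,4) that(2,4) that(3,4)]
    by (rule polynomial_upto_mono) simp
  note plus = polynomial_upto_add polynomial_upto_diff polynomial_upto_cmult pinner pP
  \<comment> \<open>By the weak relation, the increment of the integral of \<open>q . u\<close> from
    \<open>t\<close> to \<open>s\<close> is the quadrature of \<open>kin s\<close>. In both of its
    products the first factor vanishes at \<open>s = t\<close>, as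
    \<open>has_real_derivative_bilinear_vanishing\<close> requires.\<close>
  define kin where "kin s i x = (val (q s) i x - val (q t) i x) \<bullet> (val (u s) i x + val (u t) i x)
      - (val (h s) i x - val (h t) i x) \<bullet> (P (val (u s) i x) *v val (u t) i x)" for s i x
  define pot where "pot s i x = 1/2 * g * (val (h s) i x \<bullet> val (h s) i x) + g * (val (h s) i x \<bullet> val B i x)" for s i x
  \<comment> \<open>The relation at time \<open>s\<close> is tested with the velocity at another
    time \<open>r\<close>, which lies in the same space.\<close>
  have weak: "Q (\<lambda>i x. (P (val (h s) i x) *v val (u s) i x) \<bullet> val (u r) i x) = Q (\<lambda>i x. val (q s) i x \<bullet> val (u r) i x)"
    if "s \<in> {0..T}" "r \<in> {0..T}" for s r
    using velocity_eq_inner[OF vel[OF that(1)], of "u r"] DG that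
    by (simp add: quad pinner pP Q_def)
  have kin: "Q (\<lambda>i x. val (q s) i x \<bullet> val (u s) i x) = Q (kin s) + Q (\<lambda>i x. val (q t) i x \<bullet> val (u t) i x)"
    if s: "s \<in> {0..T}" for s
  proof -
    \<comment> \<open>The two bracketed differences are the weak relation at \<open>s\<close> tested
      with \<open>u t\<close>, and the one at \<open>t\<close> tested with \<open>u s\<close>; both
      have quadrature 0.\<close>
    have "kin s = (\<lambda>i x. val (q s) i x \<bullet> val (u s) i x - val (q t) i x \<bullet> val (u t) i x
       + (val (q s) i x \<bullet> val (u t) i x - (P (val (h s) i x) *v val (u s) i x) \<bullet> val (u t) i x)
       - (val (q t) i x \<bullet> val (u s) i x - (P (val (h t) i x) *v val (u t) i x) \<bullet> val (u s) i x))"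
      unfolding kin_def fun_eq_iff
      using P_inner_rotate[of "val (h s) _ _" "val (u s) _ _" "val (u t) _ _"]
        P_inner_rotate[of "val (h t) _ _" "val (u t) _ _" "val (u s) _ _"] P_commute[of "val (u t) _ _" "val (u s) _ _"]
      by (simp add: inner_add_right inner_diff_left inner_commute[of "val (h _) _ _"])
    then have "Q (kin s) = Q (\<lambda>i x. val (q s) i x \<bullet> val (u s) i x) - Q (\<lambda>i x. val (q t) i x \<bullet> val (u t) i x)
       + (Q (\<lambda>i x. val (q s) i x \<bullet> val (u t) i x) - Q (\<lambda>i x. (P (val (h s) i x) *v val (u s) i x) \<bullet> val (u t) i x))
       - (Q (\<lambda>i x. val (q t) i x \<bullet> val (u s) i x) - Q (\<lambda>i x. (P (val (h t) i x) *v val (u t) i x) \<bullet> val (u s) i x))"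
      by (simp only: Q_add Q_diff)
    then show ?thesis using weak[OF s t] weak[OF t s] by simp
  qed
  have ent: "entropy N X g B (h s) (q s) (u s) =
      Q (\<lambda>i x. pot s i x + 1/2 * kin s i x) + 1/2 * Q (\<lambda>i x. val (q t) i x \<bullet> val (u t) i x)"
    if s: "s \<in> {0..T}" for s
  proof -
    have "entropy N X g B (h s) (q s) (u s) = Q (\<lambda>i x. pot s i x + 1/2 * (val (q s) i x \<bullet> val (u s) i x))"
      unfolding entropy_def Q_def pot_def power2_norm_eq_inner using DG[OF s] B
      by (intro quad plus) auto
    then show ?thesis by (simp only: Q_add Q_cmult kin[OF s] distrib_left add.assoc)
  qed
  have rate: "entropy_rate g B (ht t) (qt t) (h t) (u t) = Q (\<lambda>i x.
     g * (val (ht t) i x \<bullet> (val (h t) i x + val B i x)) + val (qt t) i x \<bullet> val (u t) i x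
     - 1/2 * ((P (val (ht t) i x) *v val (u t) i x) \<bullet> val (u t) i x))"
    unfolding entropy_rate_def Q_def inner_add_right distrib_left using DG[OF t] DGt B
    by (intro quad plus) auto
  have node: "((\<lambda>s. pot s i x + 1/2 * kin s i x) has_real_derivative
     g * (val (ht t) i x \<bullet> (val (h t) i x + val B i x)) + val (qt t) i x \<bullet> val (u t) i x
     - 1/2 * ((P (val (ht t) i x) *v val (u t) i x) \<bullet> val (u t) i x)) (at t within {0..T})"
    if i: "i < N" and x: "x \<in> S i" for i x
  proof -
    note x = S[OF i x]
    have dh: "((\<lambda>s. val (h s) i x) has_vector_derivative val (ht t) i x) (at t within {0..T})"
      and dq: "((\<lambda>s. val (q s) i x) has_vector_derivative val (qt t) i x) (at t within {0..T})"
      using ht qt t i x by (auto simp: has_time_deriv_def)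
    have cu: "continuous (at t within {0..T}) (\<lambda>s. val (u s) i x)"
      using u[OF i x] t by (simp add: continuous_on_eq_continuous_within)
    have d1: "((\<lambda>s. val (h s) i x \<bullet> val (h s) i x) has_real_derivative
        2 * (val (ht t) i x \<bullet> val (h t) i x)) (at t within {0..T})"
      using bounded_bilinear.has_vector_derivative[OF bounded_bilinear_inner dh dh]
      by (simp add: has_real_derivative_iff_has_vector_derivative inner_commute)
    have d2: "((\<lambda>s. val (h s) i x \<bullet> val B i x) has_real_derivative
        val (ht t) i x \<bullet> val B i x) (at t within {0..T})"
      using bounded_bilinear.has_vector_derivative[OF bounded_bilinear_inner dh has_vector_derivative_const]
      by (simp add: has_real_derivative_iff_has_vector_derivative)
    have d3: "((\<lambda>s. (val (q s) i x - val (q t) i x) \<bullet> (val (u s) i x + val (u t) i x)) has_real_derivative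
        val (qt t) i x \<bullet> (val (u t) i x + val (u t) i x)) (at t within {0..T})"
      by (intro has_real_derivative_bilinear_vanishing bounded_bilinear_inner)
        (auto intro!: derivative_eq_intros dq continuous_intros cu)
    have d4: "((\<lambda>s. (val (h s) i x - val (h t) i x) \<bullet> (P (val (u s) i x) *v val (u t) i x)) has_real_derivative
        val (ht t) i x \<bullet> (P (val (u t) i x) *v val (u t) i x)) (at t within {0..T})"
      by (intro has_real_derivative_bilinear_vanishing bounded_bilinear_inner)
        (auto intro!: derivative_eq_intros dh continuous_intros cu P.continuous)
    note d3' = d3[unfolded inner_add_right[of "val (qt t) i x"]]
    show ?thesis unfolding pot_def kin_def
      by (rule derivative_eq_intros d1 d2 d3' d4 refl)+
        (simp add: inner_add_right P_inner_rotate[of "val (ht t) i x"] inner_commute[of "val (ht t) i x" "P _ *v _"] algebra_simps)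
  qed
  have "((\<lambda>s. Q (\<lambda>i x. pot s i x + 1/2 * kin s i x) + 1/2 * Q (\<lambda>i x. val (q t) i x \<bullet> val (u t) i x))
      has_real_derivative entropy_rate g B (ht t) (qt t) (h t) (u t) + 0) (at t within {0..T})"
    unfolding rate Q_def
    by (intro DERIV_add DERIV_sum DERIV_cmult DERIV_const node) auto
  then show ?thesis
    unfolding add_0_right
    \<comment> \<open>The identity \<open>ent\<close> holds on all of \<open>{0..T}\<close>, so any
      positive radius will do.\<close>
    by (rule has_field_derivative_transform_within[OF _ zero_less_one t]) (simp add: ent)
qed

end

section \<open>Persistence of the lake at rest\<close>

text \<open>Cauchy-Schwarz, from nonnegativity of the integral of \<open>(f - l r)^2\<close>. With
  \<open>R + 1\<close> in place of the squared norm \<open>R\<close> of \<open>r\<close>, the choice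
  \<open>l = I / (R + 1)\<close> covers vanishing \<open>r\<close> without a case
  distinction.\<close>

lemma integral_mult_squared_le:
  fixes f r :: "real \<Rightarrow> real"
  assumes "continuous_on {a..b} f" "continuous_on {a..b} r"
  shows "(integral {a..b} (\<lambda>x. f x * r x))\<^sup>2 \<le>
    (integral {a..b} (\<lambda>x. (r x)\<^sup>2) + 1) * integral {a..b} (\<lambda>x. (f x)\<^sup>2)"
proof -
  define I R Z where "I = integral {a..b} (\<lambda>x. f x * r x)"
    and "R = integral {a..b} (\<lambda>x. (r x)\<^sup>2)" and "Z = integral {a..b} (\<lambda>x. (f x)\<^sup>2)"
  have int: "(\<lambda>x. f x * r x) integrable_on {a..b}" "(\<lambda>x. (r x)\<^sup>2) integrable_on {a..b}"
    "(\<lambda>x. (f x)\<^sup>2) integrable_on {a..b}"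
    using assms by (auto intro!: integrable_continuous_real continuous_intros)
  define l where "l = I / (R + 1)"
  have "R \<ge> 0" unfolding R_def by (intro integral_nonneg int) auto
  have "((\<lambda>x. (f x)\<^sup>2 - 2 * l * (f x * r x) + l\<^sup>2 * (r x)\<^sup>2) has_integral Z - 2 * l * I + l\<^sup>2 * R) {a..b}"
    unfolding I_def R_def Z_def by (intro has_integral_add has_integral_diff has_integral_mult_right integrable_integral int)
  moreover have "0 \<le> (f x)\<^sup>2 - 2 * l * (f x * r x) + l\<^sup>2 * (r x)\<^sup>2" for x
    using zero_le_power2[of "f x - l * r x"] by (simp add: power2_eq_square algebra_simps)
  ultimately have "0 \<le> Z - 2 * l * I + l\<^sup>2 * R" by (rule has_integral_nonneg)
  also have "\<dots> \<le> Z - 2 * l * I + l\<^sup>2 * (R + 1)" by (simp add: algebra_simps)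
  also have l: "l * (R + 1) = I" using \<open>R \<ge> 0\<close> by (simp add: l_def)
  then have "Z - 2 * l * I + l\<^sup>2 * (R + 1) = Z - l * I"
    by (simp add: power2_eq_square mult.assoc)
  finally have "0 \<le> (R + 1) * (Z - l * I)" using \<open>R \<ge> 0\<close> by simp
  then have "I\<^sup>2 \<le> (R + 1) * Z"
    unfolding power2_eq_square l[symmetric] by (simp add: algebra_simps)
  then show ?thesis by (simp add: I_def R_def Z_def)
qed

text \<open>Cauchy-Schwarz applied to the representer of \<open>L\<close>.\<close>

lemma poly_functional_L2_bound:
  fixes L :: "real poly \<Rightarrow> real"
  assumes L: "\<And>p q c. L (p + smult c q) = L p + c * L q" and ab: "a < b"
  shows "\<exists>C. \<forall>p. degree p \<le> n \<longrightarrow> \<bar>L p\<bar> \<le> C * sqrt (integral {a..b} (\<lambda>x. (poly p x)\<^sup>2))"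
proof -
  obtain r where r: "\<And>p. degree p \<le> n \<Longrightarrow> L p = integral {a..b} (\<lambda>x. poly p x * poly r x)"
    using poly_functional_riesz[where L = L, OF L ab] by blast
  define R where "R = integral {a..b} (\<lambda>x. (poly r x)\<^sup>2) + 1"
  have "\<bar>L p\<bar> \<le> sqrt R * sqrt (integral {a..b} (\<lambda>x. (poly p x)\<^sup>2))" if "degree p \<le> n" for p
    unfolding real_sqrt_mult[symmetric] R_def r[OF that]
    by (intro real_le_rsqrt) (auto intro!: integral_mult_squared_le continuous_intros)
  then show ?thesis by blast
qed

text \<open>Each coefficient of \<open>D p\<close> is a linear functional of \<open>p\<close>, hence
  bounded by its L2 norm; powers of \<open>R\<close>, a bound for \<open>\<bar>x\<bar>\<close>, pass
  to values. With \<open>D\<close> the identity and \<open>pderiv\<close> these are the inverse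
  estimates.\<close>

lemma poly_sup_L2_bound:
  fixes D :: "real poly \<Rightarrow> real poly"
  assumes D: "\<And>p q c. D (p + smult c q) = D p + smult c (D q)"
    and deg: "\<And>p. degree p \<le> n \<Longrightarrow> degree (D p) \<le> n" and ab: "a < b"
  shows "\<exists>C. \<forall>p. degree p \<le> n \<longrightarrow> (\<forall>x\<in>{a..b}.
    \<bar>poly (D p) x\<bar> \<le> C * sqrt (integral {a..b} (\<lambda>x. (poly p x)\<^sup>2)))"
proof -
  let ?I = "\<lambda>p. sqrt (integral {a..b} (\<lambda>x. (poly p x)\<^sup>2))"
  have "\<exists>C. \<forall>p. degree p \<le> n \<longrightarrow> \<bar>coeff (D p) m\<bar> \<le> C * ?I p" for m
    by (rule poly_functional_L2_bound[OF _ ab]) (simp add: D)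
  then obtain C where C: "\<And>p m. degree p \<le> n \<Longrightarrow> \<bar>coeff (D p) m\<bar> \<le> C m * ?I p" by metis
  define R where "R = max \<bar>a\<bar> \<bar>b\<bar>"
  have "\<bar>poly (D p) x\<bar> \<le> (\<Sum>m\<le>n. C m * R ^ m) * ?I p" if p: "degree p \<le> n" and x: "x \<in> {a..b}" for p x
  proof -
    have "poly (D p) x = (\<Sum>m\<le>n. coeff (D p) m * x ^ m)"
      unfolding poly_altdef using deg[OF p]
      by (intro sum.mono_neutral_left) (auto simp: coeff_eq_0)
    also have "\<bar>\<dots>\<bar> \<le> (\<Sum>m\<le>n. \<bar>coeff (D p) m\<bar> * \<bar>x\<bar> ^ m)"
      by (rule order_trans[OF sum_abs]) (simp add: abs_mult power_abs)
    also have "\<dots> \<le> (\<Sum>m\<le>n. (C m * ?I p) * R ^ m)"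
      using x C[OF p] by (intro sum_mono mult_mono power_mono) (auto simp: R_def intro: order_trans[OF abs_ge_zero])
    finally show ?thesis by (simp add: sum_distrib_right sum_distrib_left mult_ac)
  qed
  then show ?thesis by blast
qed

text \<open>With the integrating factor \<open>exp (- c * t)\<close>, \<open>Z\<close> becomes
  nonincreasing, while it starts at 0 and stays nonnegative. \<open>c\<close> may have any
  sign.\<close>

lemma gronwall_zero:
  fixes Z Z' :: "real \<Rightarrow> real"
  assumes der: "\<And>t. t \<in> {0..T} \<Longrightarrow> (Z has_real_derivative Z' t) (at t within {0..T})"
    and le: "\<And>t. t \<in> {0..T} \<Longrightarrow> Z' t \<le> c * Z t"
    and nonneg: "\<And>t. t \<in> {0..T} \<Longrightarrow> 0 \<le> Z t" and "Z 0 = 0" and t: "t \<in> {0..T}"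
  shows "Z t = 0"
proof -
  define W where "W s = Z s * exp (- c * s)" for s
  have W: "(W has_real_derivative (Z' s - c * Z s) * exp (- c * s)) (at s within {0..T})" if "s \<in> {0..T}" for s
    unfolding W_def by (rule derivative_eq_intros der[OF that] refl)+ (simp add: algebra_simps)
  have "W t \<le> W 0"
  proof (rule DERIV_nonpos_imp_decreasing_open[of 0 t W])
    fix s assume s: "0 < s" "s < t"
    \<comment> \<open>Monotonicity asks for derivatives at interior points only, where the one-sided
      notion coincides with the usual one.\<close>
    then have "at s within {0..T} = at s" using t by (intro at_within_Icc_at) auto
    then show "\<exists>y. (W has_real_derivative y) (at s) \<and> y \<le> 0"
      using W[of s] le[of s] s t by (intro exI[of _ "(Z' s - c * Z s) * exp (- c * s)"]) (auto simp: mult_nonpos_nonneg)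
  next
    have "continuous_on {0..T} W" unfolding continuous_on_eq_continuous_within using W DERIV_continuous by blast
    then show "continuous_on {0..t} W" by (rule continuous_on_subset) (use t in auto)
  qed (use t in auto)
  then show ?thesis using nonneg[OF t] \<open>Z 0 = 0\<close> by (simp add: W_def mult_le_0_iff)
qed

section \<open>Inverse estimates for the DG space and a calculus of uniform bounds\<close>

context galerkin_mesh
begin

lemma mesh_less: "i < N \<Longrightarrow> X i < X (Suc i)" and N_pos: "0 < N"
  using mesh by (auto simp: periodic_mesh_def)

definition L2_norm :: "'K dgvec \<Rightarrow> real" where
  "L2_norm a = sqrt (mesh_int N X (\<lambda>i x. (norm (val a i x))\<^sup>2))"

lemma mesh_int_nonneg: "(\<And>i x. 0 \<le> F i x) \<Longrightarrow> 0 \<le> mesh_int N X F"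
  unfolding mesh_int_def
proof (rule sum_nonneg)
  fix i assume "\<And>i x. 0 \<le> F i x"
  then show "0 \<le> integral {X i..X (Suc i)} (F i)"
    \<comment> \<open>A non-integrable integrand has integral 0 by convention.\<close>
    by (cases "F i integrable_on {X i..X (Suc i)}") (simp_all add: integral_nonneg not_integrable_integral)
qed

lemma L2_norm_nonneg: "0 \<le> L2_norm a"
  by (simp add: L2_norm_def mesh_int_nonneg)

lemma L2_norm_squared: "(L2_norm a)\<^sup>2 = mesh_int N X (\<lambda>i x. val a i x \<bullet> val a i x)"
  by (simp add: L2_norm_def mesh_int_nonneg power2_norm_eq_inner)

lemma component_L2_le:
  assumes "i < N"
  shows "sqrt (integral {X i..X (Suc i)} (\<lambda>x. (poly (a i $ j) x)\<^sup>2)) \<le> L2_norm a"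
proof -
  have "integral {X i..X (Suc i)} (\<lambda>x. (poly (a i $ j) x)\<^sup>2) \<le> integral {X i..X (Suc i)} (\<lambda>x. (norm (val a i x))\<^sup>2)"
  proof (rule integral_le)
    fix x
    have "(val a i x $ j)\<^sup>2 \<le> (norm (val a i x))\<^sup>2"
      using power_mono[OF component_le_norm_cart abs_ge_zero, of "val a i x" j 2] by simp
    then show "(poly (a i $ j) x)\<^sup>2 \<le> (norm (val a i x))\<^sup>2" by (simp add: val_nth)
  qed (auto intro!: integrable_continuous_real continuous_intros)
  also have "\<dots> \<le> mesh_int N X (\<lambda>i x. (norm (val a i x))\<^sup>2)"
    unfolding mesh_int_def using assms
    by (intro member_le_sum) (auto intro!: integral_nonneg integrable_continuous_real continuous_intros)
  finally show ?thesis by (simp add: L2_norm_def)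
qed

lemma DGvec_sup_le_L2:
  "\<exists>C. \<forall>a\<in>DGvec N k. \<forall>i<N. \<forall>x\<in>{X i..X (Suc i)}.
     norm (val a i x) \<le> C * L2_norm a \<and> norm (dx a i x) \<le> C * L2_norm a"
proof -
  have "\<exists>C. \<forall>p. degree p \<le> k \<longrightarrow> (\<forall>x\<in>{X i..X (Suc i)}.
     \<bar>poly p x\<bar> \<le> C * sqrt (integral {X i..X (Suc i)} (\<lambda>x. (poly p x)\<^sup>2)) \<and>
     \<bar>poly (pderiv p) x\<bar> \<le> C * sqrt (integral {X i..X (Suc i)} (\<lambda>x. (poly p x)\<^sup>2)))" if i: "i < N" for i
  proof -
    let ?I = "\<lambda>p. sqrt (integral {X i..X (Suc i)} (\<lambda>x. (poly p x)\<^sup>2))"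
    obtain C where C: "\<And>p x. degree p \<le> k \<Longrightarrow> x \<in> {X i..X (Suc i)} \<Longrightarrow> \<bar>poly p x\<bar> \<le> C * ?I p"
      using poly_sup_L2_bound[of "\<lambda>p. p" k, OF _ _ mesh_less[OF i]] by force
    obtain C' where C': "\<And>p x. degree p \<le> k \<Longrightarrow> x \<in> {X i..X (Suc i)} \<Longrightarrow> \<bar>poly (pderiv p) x\<bar> \<le> C' * ?I p"
      using poly_sup_L2_bound[of pderiv k, OF _ _ mesh_less[OF i]]
      by (force simp: pderiv_add pderiv_smult degree_pderiv)
    have "C * ?I p \<le> max C C' * ?I p" "C' * ?I p \<le> max C C' * ?I p" for p
      by (auto intro!: mult_right_mono integral_nonneg integrable_continuous_real continuous_intros)
    then show ?thesis using C C' by (intro exI[of _ "max C C'"]) (meson order_trans)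
  qed
  then obtain C where C: "\<And>i p x. i < N \<Longrightarrow> degree p \<le> k \<Longrightarrow> x \<in> {X i..X (Suc i)} \<Longrightarrow>
     \<bar>poly p x\<bar> \<le> C i * sqrt (integral {X i..X (Suc i)} (\<lambda>x. (poly p x)\<^sup>2)) \<and>
     \<bar>poly (pderiv p) x\<bar> \<le> C i * sqrt (integral {X i..X (Suc i)} (\<lambda>x. (poly p x)\<^sup>2))"
    by metis
  \<comment> \<open>\<open>D\<close> bounds the finitely many element constants at once; the later
    factor \<open>CARD('K)\<close> pays for bounding the Euclidean norm by the sum of the
    components.\<close>
  define D where "D = (\<Sum>i<N. \<bar>C i\<bar>)"
  have "norm (val a i x) \<le> (CARD('K) * D) * L2_norm a \<and> norm (dx a i x) \<le> (CARD('K) * D) * L2_norm a"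
    if a: "a \<in> DGvec N k" and i: "i < N" and x: "x \<in> {X i..X (Suc i)}" for a i x
  proof -
    have le: "C i * sqrt (integral {X i..X (Suc i)} (\<lambda>x. (poly (a i $ j) x)\<^sup>2)) \<le> D * L2_norm a" for j
    proof (rule mult_mono)
      show "C i \<le> D" unfolding D_def using i member_le_sum[of i "{..<N}" "\<lambda>i. \<bar>C i\<bar>"] by simp
      show "0 \<le> D" by (simp add: D_def sum_nonneg)
    qed (use component_L2_le[OF i] in \<open>auto intro!: integral_nonneg integrable_continuous_real continuous_intros\<close>)
    have "degree (a i $ j) \<le> k" for j using a i by (auto simp: DGvec_iff)
    note b = C[OF i this x]
    have "norm (val a i x) \<le> (\<Sum>j\<in>UNIV. \<bar>val a i x $ j\<bar>)" by (rule norm_le_l1_cart)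
    also have "\<dots> \<le> (\<Sum>j\<in>(UNIV::'K set). D * L2_norm a)"
      unfolding val_nth by (intro sum_mono order_trans[OF conjunct1[OF b] le])
    finally have 1: "norm (val a i x) \<le> (CARD('K) * D) * L2_norm a" by simp
    have "norm (dx a i x) \<le> (\<Sum>j\<in>UNIV. \<bar>dx a i x $ j\<bar>)" by (rule norm_le_l1_cart)
    also have "\<dots> \<le> (\<Sum>j\<in>(UNIV::'K set). D * L2_norm a)"
      unfolding dx_nth by (intro sum_mono order_trans[OF conjunct2[OF b] le])
    finally show ?thesis using 1 by simp
  qed
  then show ?thesis by blast
qed

text \<open>A big-O relation, uniform in time, element and point, with the constant hidden. Size 1
  means boundedness on \<open>A\<close>. Interface terms and integrals fit in as functions that
  ignore \<open>x\<close>, or both \<open>i\<close> and \<open>x\<close>.\<close>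

definition dominated :: "real set \<Rightarrow> (real \<Rightarrow> real) \<Rightarrow> (real \<Rightarrow> nat \<Rightarrow> real \<Rightarrow> 'v::real_normed_vector) \<Rightarrow> bool" where
  "dominated A m F \<longleftrightarrow> (\<exists>c. \<forall>t\<in>A. \<forall>i<N. \<forall>x\<in>{X i..X (Suc i)}. norm (F t i x) \<le> c * m t)"

lemma dominatedI:
  "(\<And>t i x. t \<in> A \<Longrightarrow> i < N \<Longrightarrow> x \<in> {X i..X (Suc i)} \<Longrightarrow> norm (F t i x) \<le> c * m t) \<Longrightarrow> dominated A m F"
  unfolding dominated_def by blast

lemma dominatedE:
  assumes "dominated A m F"
  obtains c where "\<And>t i x. t \<in> A \<Longrightarrow> i < N \<Longrightarrow> x \<in> {X i..X (Suc i)} \<Longrightarrow> norm (F t i x) \<le> c * m t"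
  using assms unfolding dominated_def by blast

lemma dominated_cong:
  "dominated A m F \<Longrightarrow> (\<And>t i x. t \<in> A \<Longrightarrow> i < N \<Longrightarrow> x \<in> {X i..X (Suc i)} \<Longrightarrow> G t i x = F t i x) \<Longrightarrow> dominated A m G"
  unfolding dominated_def by (metis (no_types, lifting))

lemma dominated_trans:
  assumes "dominated A m F" "dominated A m' (\<lambda>t i x. m t)"
  shows "dominated A m' F"
proof -
  obtain c where c: "\<And>t i x. t \<in> A \<Longrightarrow> i < N \<Longrightarrow> x \<in> {X i..X (Suc i)} \<Longrightarrow> norm (F t i x) \<le> c * m t"
    using assms(1) by (rule dominatedE) blast
  obtain d where d: "\<And>t i x. t \<in> A \<Longrightarrow> i < N \<Longrightarrow> x \<in> {X i..X (Suc i)} \<Longrightarrow> norm (m t) \<le> d * m' t"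
    using assms(2) by (rule dominatedE) blast
  show ?thesis
  proof (rule dominatedI)
    fix t i x assume tix: "t \<in> A" "i < N" "x \<in> {X i..X (Suc i)}"
    \<comment> \<open>Absolute values, because neither \<open>c\<close> nor \<open>m t\<close> is
      known to be nonnegative.\<close>
    have "norm (F t i x) \<le> \<bar>c\<bar> * \<bar>m t\<bar>" using c[OF tix] by (metis abs_ge_self abs_mult order_trans)
    also have "\<dots> \<le> \<bar>c\<bar> * (d * m' t)" using d[OF tix] by (intro mult_left_mono) auto
    finally show "norm (F t i x) \<le> (\<bar>c\<bar> * d) * m' t" by (simp add: mult_ac)
  qed
qed

lemma dominated_add:
  assumes "dominated A m F" "dominated A m G"
  shows "dominated A m (\<lambda>t i x. F t i x + G t i x)"
proof -
  obtain c d where cd: "\<And>t i x. t \<in> A \<Longrightarrow> i < N \<Longrightarrow> x \<in> {X i..X (Suc i)} \<Longrightarrow> norm (F t i x) \<le> c * m t"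
    "\<And>t i x. t \<in> A \<Longrightarrow> i < N \<Longrightarrow> x \<in> {X i..X (Suc i)} \<Longrightarrow> norm (G t i x) \<le> d * m t"
    using assms by (metis dominatedE)
  show ?thesis
    by (rule dominatedI[where c = "c + d"])
      (use cd in \<open>auto intro!: norm_triangle_le add_mono simp: distrib_right\<close>)
qed

text \<open>Sizes multiply: two small factors give the quadratic bound for Gronwall, a small and a
  bounded one keep the size.\<close>

lemma dominated_bilinear:
  assumes "bounded_bilinear mul" and "dominated A m F" "dominated A m' G"
  shows "dominated A (\<lambda>t. m t * m' t) (\<lambda>t i x. mul (F t i x) (G t i x))"
proof -
  interpret bounded_bilinear mul by fact
  obtain K where K: "0 \<le> K" "\<And>a b. norm (mul a b) \<le> norm a * norm b * K" using nonneg_bounded by blast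
  obtain c d where cd: "\<And>t i x. t \<in> A \<Longrightarrow> i < N \<Longrightarrow> x \<in> {X i..X (Suc i)} \<Longrightarrow> norm (F t i x) \<le> c * m t"
    "\<And>t i x. t \<in> A \<Longrightarrow> i < N \<Longrightarrow> x \<in> {X i..X (Suc i)} \<Longrightarrow> norm (G t i x) \<le> d * m' t"
    using assms(2,3) by (metis dominatedE)
  show ?thesis
  proof (rule dominatedI)
    fix t i x assume tix: "t \<in> A" "i < N" "x \<in> {X i..X (Suc i)}"
    have "norm (mul (F t i x) (G t i x)) \<le> norm (F t i x) * norm (G t i x) * K" by (rule K)
    also have "\<dots> \<le> (c * m t) * (d * m' t) * K"
      using cd[OF tix] K(1) by (intro mult_right_mono mult_mono) (auto intro: order_trans[OF norm_ge_zero])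
    finally show "norm (mul (F t i x) (G t i x)) \<le> (c * d * K) * (m t * m' t)" by (simp add: mult_ac)
  qed
qed

lemma dominated_linear:
  assumes "bounded_linear f" and "dominated A m F"
  shows "dominated A m (\<lambda>t i x. f (F t i x))"
proof -
  interpret bounded_linear f by fact
  obtain K where K: "0 \<le> K" "\<And>a. norm (f a) \<le> norm a * K" using nonneg_bounded by blast
  obtain c where c: "\<And>t i x. t \<in> A \<Longrightarrow> i < N \<Longrightarrow> x \<in> {X i..X (Suc i)} \<Longrightarrow> norm (F t i x) \<le> c * m t"
    using assms(2) by (rule dominatedE) blast
  show ?thesis
  proof (rule dominatedI)
    fix t i x assume tix: "t \<in> A" "i < N" "x \<in> {X i..X (Suc i)}"
    show "norm (f (F t i x)) \<le> (c * K) * m t"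
      using mult_right_mono[OF c[OF tix] K(1)] K(2)[of "F t i x"] by (simp add: mult_ac)
  qed
qed

lemma dominated_diff:
  assumes "dominated A m F" "dominated A m G"
  shows "dominated A m (\<lambda>t i x. F t i x - G t i x)"
  using dominated_add[OF assms(1) dominated_linear[OF bounded_linear_minus[OF bounded_linear_ident] assms(2)]] by simp

lemma dominated_scaleR: "dominated A m F \<Longrightarrow> dominated A m (\<lambda>t i x. c *\<^sub>R F t i x)"
  by (rule dominated_linear[OF bounded_linear_scaleR_right])

lemma dominated_cmult: "dominated A m F \<Longrightarrow> dominated A m (\<lambda>t i x. c * F t i x)" for c :: real
  by (rule dominated_linear[OF bounded_linear_mult_right])

lemma dominated_zero: "dominated A m (\<lambda>t i x. 0)"
  by (rule dominatedI[where c = 0]) simp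

lemma dominated_sum:
  assumes "\<And>j. j \<in> J \<Longrightarrow> dominated A m (F j)"
  shows "dominated A m (\<lambda>t i x. \<Sum>j\<in>J. F j t i x)"
  using assms by (induction J rule: infinite_finite_induct) (auto intro: dominated_add dominated_zero)

lemma right_end_in: "i < N \<Longrightarrow> X (Suc i) \<in> {X i..X (Suc i)}"
  and left_end_in: "i < N \<Longrightarrow> X i \<in> {X i..X (Suc i)}"
  and next_less: "Suc i mod N < N"
  using mesh_less[of i] N_pos by auto

lemma dominated_traces:
  assumes "dominated A m F"
  shows "dominated A m (\<lambda>t i x. trace_plus N X (F t) i)" "dominated A m (\<lambda>t i x. trace_minus X (F t) i)"
proof -
  obtain c where c: "\<And>t i x. t \<in> A \<Longrightarrow> i < N \<Longrightarrow> x \<in> {X i..X (Suc i)} \<Longrightarrow> norm (F t i x) \<le> c * m t"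
    using assms by (rule dominatedE) blast
  show "dominated A m (\<lambda>t i x. trace_plus N X (F t) i)"
    unfolding trace_plus_def using left_end_in[OF next_less] next_less by (intro dominatedI[where c = c] c) auto
  show "dominated A m (\<lambda>t i x. trace_minus X (F t) i)"
    unfolding trace_minus_def using right_end_in by (intro dominatedI[where c = c] c) auto
qed

lemma dominated_jump: "dominated A m F \<Longrightarrow> dominated A m (\<lambda>t i x. jump N X (F t) i)"
  and dominated_avg: "dominated A m F \<Longrightarrow> dominated A m (\<lambda>t i x. avg N X (F t) i)"
  unfolding jump_def avg_def by (intro dominated_traces dominated_diff dominated_add dominated_scaleR; assumption)+

lemma dominated_interface_sum:
  assumes "dominated A m (\<lambda>t i x. F t i)"
  shows "dominated A m (\<lambda>t i' x. \<Sum>i<N. F t i)"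
proof (rule dominated_sum)
  fix i assume i: "i \<in> {..<N}"
  obtain c where c: "\<And>t i x. t \<in> A \<Longrightarrow> i < N \<Longrightarrow> x \<in> {X i..X (Suc i)} \<Longrightarrow> norm (F t i) \<le> c * m t"
    using assms by (rule dominatedE) blast
  show "dominated A m (\<lambda>t i' x. F t i)"
    \<comment> \<open>The interface quantity ignores \<open>x\<close>, but its bound is quantified
      over points of the element; the right end supplies one.\<close>
    by (rule dominatedI) (use i c right_end_in in blast)
qed

lemma dominated_mesh_int:
  assumes "dominated A m F"
  shows "dominated A m (\<lambda>t i x. mesh_int N X (F t))"
  unfolding mesh_int_def
proof (rule dominated_interface_sum)
  obtain c where c: "\<And>t i x. t \<in> A \<Longrightarrow> i < N \<Longrightarrow> x \<in> {X i..X (Suc i)} \<Longrightarrow> norm (F t i x) \<le> c * m t"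
    using assms by (rule dominatedE) blast
  \<comment> \<open>The total length of the mesh bounds the length of each element.\<close>
  define l where "l = (\<Sum>i<N. X (Suc i) - X i)"
  show "dominated A m (\<lambda>t i x. integral {X i..X (Suc i)} (F t i))"
  proof (rule dominatedI)
    fix t i x assume t: "t \<in> A" and i: "i < N"
    have nonneg: "0 \<le> c * m t" using c[OF t i left_end_in[OF i]] norm_ge_zero order_trans by blast
    have "norm (integral {X i..X (Suc i)} (F t i)) \<le> c * m t * (X (Suc i) - X i)"
    proof (cases "F t i integrable_on {X i..X (Suc i)}")
      case True
      then show ?thesis
        using has_integral_bound_real[OF nonneg finite.emptyI integrable_integral[OF True]] c[OF t i] mesh_less[OF i] by simp
    next
      case False
      then show ?thesis using nonneg mesh_less[OF i] by (simp add: not_integrable_integral)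
    qed
    also have "\<dots> \<le> c * m t * l"
      unfolding l_def using nonneg i mesh_less
      by (intro mult_left_mono member_le_sum) (auto simp: less_imp_le)
    finally show "norm (integral {X i..X (Suc i)} (F t i)) \<le> (c * l) * m t" by (simp add: mult_ac)
  qed
qed

lemma dominated_elementwise:
  assumes "\<And>t. t \<in> A \<Longrightarrow> 0 \<le> m t"
    and "\<And>i. i < N \<Longrightarrow> \<exists>c. \<forall>t\<in>A. \<forall>x\<in>{X i..X (Suc i)}. norm (F t i x) \<le> c * m t"
  shows "dominated A m F"
proof -
  obtain c where c: "\<And>i t x. i < N \<Longrightarrow> t \<in> A \<Longrightarrow> x \<in> {X i..X (Suc i)} \<Longrightarrow> norm (F t i x) \<le> c i * m t"
    using assms(2) by metis
  show ?thesis
  proof (rule dominatedI)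
    fix t i x assume tix: "t \<in> A" "i < N" "x \<in> {X i..X (Suc i)}"
    have "c i \<le> (\<Sum>i<N. \<bar>c i\<bar>)" using tix(2) member_le_sum[of i "{..<N}" "\<lambda>i. \<bar>c i\<bar>"] by simp
    then show "norm (F t i x) \<le> (\<Sum>i<N. \<bar>c i\<bar>) * m t"
      using c[OF tix(2,1,3)] assms(1)[OF tix(1)] mult_right_mono order_trans by blast
  qed
qed

lemma dominated_static:
  assumes "\<And>i. i < N \<Longrightarrow> continuous_on {X i..X (Suc i)} (F i)"
  shows "dominated A (\<lambda>_. 1) (\<lambda>t. F)"
proof (rule dominated_elementwise)
  fix i assume "i < N"
  then have "bounded (F i ` {X i..X (Suc i)})"
    using assms by (intro compact_imp_bounded compact_continuous_image) auto
  then show "\<exists>c. \<forall>t\<in>A. \<forall>x\<in>{X i..X (Suc i)}. norm (F i x) \<le> c * 1"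
    by (auto simp: bounded_iff)
qed simp

lemma dominated_mult_left:
  assumes "bounded_bilinear mul" "dominated A m F" "dominated A (\<lambda>_. 1) G"
  shows "dominated A m (\<lambda>t i x. mul (F t i x) (G t i x))"
  using dominated_bilinear[OF assms] by simp

lemma dominated_mult_right:
  assumes "bounded_bilinear mul" "dominated A (\<lambda>_. 1) F" "dominated A m G"
  shows "dominated A m (\<lambda>t i x. mul (F t i x) (G t i x))"
  using dominated_bilinear[OF assms] by simp

lemma dominated_componentwise:
  fixes F :: "real \<Rightarrow> nat \<Rightarrow> real \<Rightarrow> real^'n::finite"
  assumes "\<And>j. dominated A m (\<lambda>t i x. F t i x $ j)"
  shows "dominated A m F"
proof -
  have "dominated A m (\<lambda>t i x. \<Sum>j\<in>UNIV. (F t i x $ j) *\<^sub>R axis j (1::real))"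
    by (intro dominated_sum dominated_linear[OF bounded_linear_scaleR_left] assms)
  then show ?thesis
    by (rule dominated_cong) (simp add: basis_expansion flip: scalar_mult_eq_scaleR)
qed

lemma dominated_L2:
  assumes "\<And>t. t \<in> A \<Longrightarrow> a t \<in> DGvec N k"
  shows "dominated A (\<lambda>t. L2_norm (a t)) (\<lambda>t. val (a t))" "dominated A (\<lambda>t. L2_norm (a t)) (\<lambda>t. dx (a t))"
proof -
  obtain C where "\<And>a i x. a \<in> DGvec N k \<Longrightarrow> i < N \<Longrightarrow> x \<in> {X i..X (Suc i)} \<Longrightarrow>
     norm (val a i x) \<le> C * L2_norm a \<and> norm (dx a i x) \<le> C * L2_norm a"
    using DGvec_sup_le_L2[of k] by metis
  then show "dominated A (\<lambda>t. L2_norm (a t)) (\<lambda>t. val (a t))" "dominated A (\<lambda>t. L2_norm (a t)) (\<lambda>t. dx (a t))"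
    using assms by (auto intro!: dominatedI[where c = C])
qed

section \<open>The L2 norm as a function of time\<close>

lemma inner_quadrature:
  obtains S w where "\<And>i x. i < N \<Longrightarrow> x \<in> S i \<Longrightarrow> x \<in> {X i..X (Suc i)}"
    and "\<And>a b :: 'K dgvec. a \<in> DGvec N k \<Longrightarrow> b \<in> DGvec N k \<Longrightarrow>
      mesh_int N X (\<lambda>i x. val a i x \<bullet> val b i x) = (\<Sum>i<N. \<Sum>x\<in>S i. w i x * (val a i x \<bullet> val b i x))"
proof -
  obtain S w where S: "\<And>i. i < N \<Longrightarrow> S i \<subseteq> {X i..X (Suc i)}"
    and quad: "\<And>F. (\<And>i. i < N \<Longrightarrow> polynomial_upto (k + k) (F i)) \<Longrightarrow>
        mesh_int N X F = (\<Sum>i<N. \<Sum>s\<in>S i. w i s * F i s)"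
    using mesh_quadrature[OF mesh, of "k + k"] by blast
  have "mesh_int N X (\<lambda>i x. val a i x \<bullet> val b i x) = (\<Sum>i<N. \<Sum>x\<in>S i. w i x * (val a i x \<bullet> val b i x))"
    if "a \<in> DGvec N k" "b \<in> DGvec N k" for a b :: "'K dgvec"
    by (rule quad) (rule polynomial_upto_inner polynomial_upto_val that | assumption)+
  with subsetD[OF S] show ?thesis by (rule that)
qed

text \<open>Continuity in time is known only at fixed points \<open>x\<close>. Quadrature reduces
  the squared norm to finitely many such points, and compactness of \<open>{0..T}\<close> yields the
  bound.\<close>

lemma L2_norm_bounded:
  assumes "\<And>t. t \<in> {0..T} \<Longrightarrow> a t \<in> DGvec N k"
    and cont: "\<And>i x. i < N \<Longrightarrow> x \<in> {X i..X (Suc i)} \<Longrightarrow> continuous_on {0..T} (\<lambda>t. val (a t) i x)"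
  shows "dominated {0..T} (\<lambda>_. 1) (\<lambda>t i x. L2_norm (a t))"
proof -
  obtain S w where S: "\<And>i x. i < N \<Longrightarrow> x \<in> S i \<Longrightarrow> x \<in> {X i..X (Suc i)}"
    and quad: "\<And>a b :: 'K dgvec. a \<in> DGvec N k \<Longrightarrow> b \<in> DGvec N k \<Longrightarrow>
      mesh_int N X (\<lambda>i x. val a i x \<bullet> val b i x) = (\<Sum>i<N. \<Sum>x\<in>S i. w i x * (val a i x \<bullet> val b i x))"
    by (rule inner_quadrature[of k]) blast
  have "continuous_on {0..T} (\<lambda>t. \<Sum>i<N. \<Sum>x\<in>S i. w i x * (val (a t) i x \<bullet> val (a t) i x))"
    using S by (intro continuous_intros cont) auto
  then have "continuous_on {0..T} (\<lambda>t. (L2_norm (a t))\<^sup>2)"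
    by (rule continuous_on_eq) (simp add: L2_norm_squared quad assms(1))
  then have "continuous_on {0..T} (\<lambda>t. sqrt ((L2_norm (a t))\<^sup>2))" by (rule continuous_on_real_sqrt)
  then have "compact ((\<lambda>t. L2_norm (a t)) ` {0..T})"
    by (intro compact_continuous_image) (simp_all add: L2_norm_nonneg)
  then obtain c where "\<forall>x\<in>(\<lambda>t. L2_norm (a t)) ` {0..T}. norm x \<le> c"
    using compact_imp_bounded bounded_iff by blast
  then show ?thesis by (intro dominatedI[where c = c]) auto
qed

lemma L2_norm_has_derivative:
  assumes t: "t \<in> {0..T}" and DG: "\<And>s. s \<in> {0..T} \<Longrightarrow> a s \<in> DGvec N k" and DGt: "a' t \<in> DGvec N k"
    and der: "has_time_deriv N X T a a'"
  shows "((\<lambda>s. (L2_norm (a s))\<^sup>2) has_real_derivative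
     2 * mesh_int N X (\<lambda>i x. val (a' t) i x \<bullet> val (a t) i x)) (at t within {0..T})"
proof -
  obtain S w where S: "\<And>i x. i < N \<Longrightarrow> x \<in> S i \<Longrightarrow> x \<in> {X i..X (Suc i)}"
    and quad: "\<And>a b :: 'K dgvec. a \<in> DGvec N k \<Longrightarrow> b \<in> DGvec N k \<Longrightarrow>
      mesh_int N X (\<lambda>i x. val a i x \<bullet> val b i x) = (\<Sum>i<N. \<Sum>x\<in>S i. w i x * (val a i x \<bullet> val b i x))"
    by (rule inner_quadrature[of k]) blast
  have "((\<lambda>s. val (a s) i x \<bullet> val (a s) i x) has_real_derivative
      2 * (val (a' t) i x \<bullet> val (a t) i x)) (at t within {0..T})" if "i < N" "x \<in> S i" for i x
  proof -
    have d: "((\<lambda>s. val (a s) i x) has_vector_derivative val (a' t) i x) (at t within {0..T})"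
      using der t S[OF that] that(1) by (auto simp: has_time_deriv_def)
    show ?thesis
      using bounded_bilinear.has_vector_derivative[OF bounded_bilinear_inner d d]
      by (simp add: has_real_derivative_iff_has_vector_derivative inner_commute)
  qed
  then have "((\<lambda>s. \<Sum>i<N. \<Sum>x\<in>S i. w i x * (val (a s) i x \<bullet> val (a s) i x)) has_real_derivative
      (\<Sum>i<N. \<Sum>x\<in>S i. w i x * (2 * (val (a' t) i x \<bullet> val (a t) i x)))) (at t within {0..T})"
    by (intro DERIV_sum DERIV_cmult) auto
  also have "(\<Sum>i<N. \<Sum>x\<in>S i. w i x * (2 * (val (a' t) i x \<bullet> val (a t) i x))) =
      2 * mesh_int N X (\<lambda>i x. val (a' t) i x \<bullet> val (a t) i x)"
    by (simp add: quad[OF DGt DG[OF t]] sum_distrib_left mult_ac)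
  finally show ?thesis
    by (rule has_field_derivative_transform_within[OF _ zero_less_one t])
      (simp add: L2_norm_squared quad DG)
qed

text \<open>Members of the DG space may jump, so a polynomial on one element extended by 0 is a test
  function; it isolates single moments of the velocity equation.\<close>

lemma mesh_int_single_element:
  assumes "i < N"
  shows "mesh_int N X (\<lambda>i' x. F i' x * poly (if i' = i then p else 0) x) =
    integral {X i..X (Suc i)} (\<lambda>x. F i x * poly p x)"
proof -
  have "mesh_int N X (\<lambda>i' x. F i' x * poly (if i' = i then p else 0) x) =
      (\<Sum>i'<N. if i' = i then integral {X i..X (Suc i)} (\<lambda>x. F i x * poly p x) else 0)"
    unfolding mesh_int_def by (intro sum.cong) auto
  then show ?thesis using assms by simp
qed

text \<open>An injective linear map on a finite-dimensional space has a left inverse: the coefficients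
  of the velocity are fixed linear combinations of the moments of \<open>P h\<^sub>0 u\<close>. Since
  \<open>P h\<^sub>0 u = q - P (h - h\<^sub>0) u\<close> weakly and \<open>u\<close> is bounded, a bound for
  \<open>q\<close> and \<open>h - h\<^sub>0\<close> is one for \<open>u\<close>.\<close>

lemma velocity_dominated:
  assumes det: "velocity_determined P N X k h0"
    and u: "\<And>t. t \<in> A \<Longrightarrow> u t \<in> DGvec N k"
    and vel: "\<And>t. t \<in> A \<Longrightarrow> velocity_eq P N X k (h t) (q t) (u t)"
    and m: "\<And>t. t \<in> A \<Longrightarrow> 0 \<le> m t"
    and dq: "dominated A m (\<lambda>t. val (q t))"
    and dh: "dominated A m (\<lambda>t i x. val (h t) i x - val h0 i x)"
    and bu: "dominated A (\<lambda>_. 1) (\<lambda>t. val (u t))"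
  shows "dominated A m (\<lambda>t. val (u t))"
proof -
  define f where "f = (\<lambda>(i, n, j) (v :: 'K dgvec).
      integral {X i..X (Suc i)} (\<lambda>x. (P (val h0 i x) *v val v i x) $ j * x ^ n))"
  define I where "I = {..<N} \<times> {..k} \<times> (UNIV :: 'K set)"
  have I: "finite I" by (simp add: I_def)
  have fin: "(\<lambda>x. (P (val h0 i x) *v val v i x) $ j * x ^ n) integrable_on {X i..X (Suc i)}"
    for v :: "'K dgvec" and i j n
    by (intro integrable_continuous_real continuous_intros)
  have "\<exists>c. \<forall>v\<in>DGvec N k. coeff (v i $ j) n = (\<Sum>z\<in>I. c z * f z v)" if i: "i < N" for i j n
  proof (rule functional_in_span[OF I])
    fix v w :: "'K dgvec" and c :: real
    assume vw: "v \<in> DGvec N k" "w \<in> DGvec N k"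
    define z where "z = (\<lambda>i. \<chi> j. v i $ j + smult c (w i $ j))"
    have "z \<in> DGvec N k"
      using vw by (auto simp: DGvec_iff z_def intro!: degree_add_le order_trans[OF degree_smult_le])
    moreover have "f y z = f y v + c * f y w" for y
    proof -
      obtain i n j where y: "y = (i, n, j)" by (cases y)
      have "val z i x = val v i x + c *\<^sub>R val w i x" for x
        by (simp add: val_def z_def vec_eq_iff)
      then have "f y z = integral {X i..X (Suc i)} (\<lambda>x. (P (val h0 i x) *v val v i x) $ j * x ^ n
          + c * ((P (val h0 i x) *v val w i x) $ j * x ^ n))"
        by (simp add: y f_def P.add_right P.scaleR_right distrib_right mult.assoc)
      also have "\<dots> = f y v + c * f y w"
        by (subst integral_add) (auto intro!: fin integrable_on_mult_right simp: y f_def)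
      finally show ?thesis .
    qed
    moreover have "coeff (z i $ j) n = coeff (v i $ j) n + c * coeff (w i $ j) n"
      by (simp add: z_def)
    ultimately show "\<exists>z\<in>DGvec N k. (\<forall>y\<in>I. f y z = f y v + c * f y w) \<and>
       coeff (z i $ j) n = coeff (v i $ j) n + c * coeff (w i $ j) n" by blast
  next
    fix v :: "'K dgvec" assume v: "v \<in> DGvec N k" and f0: "\<forall>z\<in>I. f z v = 0"
    have val0: "val (\<lambda>i. 0) i x = 0" for i x by (simp add: val_def vec_eq_iff)
    have z: "(\<lambda>i. 0) \<in> DGvec N k" by (simp add: DGvec_iff)
    \<comment> \<open>With all moments 0, \<open>v\<close> solves the velocity equation for zero
      discharge, and so does the zero field; determinacy makes them agree on the elements.\<close>
    have "velocity_eq P N X k h0 (\<lambda>i. 0) v"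
      unfolding velocity_eq_def
    proof (intro allI ballI)
      fix j w assume w: "w \<in> DG N k"
      show "mesh_int N X (\<lambda>i x. (P (val h0 i x) *v val v i x - val (\<lambda>i. 0) i x) $ j * poly (w i) x) = 0"
        unfolding mesh_int_def
      proof (intro sum.neutral ballI)
        fix i assume i: "i \<in> {..<N}"
        have "poly (w i) x = (\<Sum>n\<le>k. coeff (w i) n * x ^ n)" for x
          unfolding poly_altdef using w i
          by (intro sum.mono_neutral_left) (auto simp: DG_def coeff_eq_0)
        then have "integral {X i..X (Suc i)} (\<lambda>x. (P (val h0 i x) *v val v i x - val (\<lambda>i. 0) i x) $ j * poly (w i) x) =
           integral {X i..X (Suc i)} (\<lambda>x. \<Sum>n\<le>k. coeff (w i) n * ((P (val h0 i x) *v val v i x) $ j * x ^ n))"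
          by (simp add: val0 sum_distrib_left mult_ac)
        also have "\<dots> = (\<Sum>n\<le>k. coeff (w i) n * f (i, n, j) v)"
          by (subst integral_sum) (auto intro!: integrable_on_mult_right fin simp: f_def)
        also have "\<dots> = 0" using f0 i by (intro sum.neutral) (auto simp: I_def)
        finally show "integral {X i..X (Suc i)} (\<lambda>x. (P (val h0 i x) *v val v i x - val (\<lambda>i. 0) i x) $ j * poly (w i) x) = 0" .
      qed
    qed
    moreover have "velocity_eq P N X k h0 (\<lambda>i. 0) (\<lambda>i. 0)"
      by (simp add: velocity_eq_def val0 mesh_int_def)
    ultimately have "v i = 0"
      using det[unfolded velocity_determined_def, rule_format, OF z v z] i by simp
    then show "coeff (v i $ j) n = 0" by simp
  qed
  \<comment> \<open>\<open>c\<close> does not depend on \<open>v\<close>, so the same combination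
    serves \<open>u t\<close> at every time.\<close>
  then obtain c where c: "\<And>i j n v. i < N \<Longrightarrow> v \<in> DGvec N k \<Longrightarrow> coeff (v i $ j) n = (\<Sum>z\<in>I. c i j n z * f z v)"
    by metis
  have df: "dominated A m (\<lambda>t i x. f z (u t))" if z: "z \<in> I" for z
  proof -
    obtain i n j where zi: "z = (i, n, j)" "i < N" "n \<le> k" using z by (auto simp: I_def)
    define w where "w i' = (if i' = i then monom 1 n else 0 :: real poly)" for i'
    have w: "w \<in> DG N k" using zi by (auto simp: DG_def w_def intro: order_trans[OF degree_monom_le])
    \<comment> \<open>\<open>h - h0\<close> has size \<open>m\<close> and \<open>u\<close> is
      bounded, so their product has size \<open>m\<close>; this is where \<open>bu\<close>
      enters.\<close>
    have "dominated A m (\<lambda>t i x. mesh_int N X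
        (\<lambda>i x. (val (q t) i x - P (val (h t) i x - val h0 i x) *v val (u t) i x) $ j * poly (w i) x))"
      by (intro dominated_mesh_int dominated_mult_left[OF bounded_bilinear_mult] dominated_linear[OF bounded_linear_vec_nth]
          dominated_diff dq dominated_mult_left[OF bounded_bilinear_P] dh bu dominated_static continuous_intros)
    then show ?thesis
    proof (rule dominated_cong)
      fix t assume t: "t \<in> A"
      have "f z (u t) = mesh_int N X (\<lambda>i x. (P (val h0 i x) *v val (u t) i x) $ j * poly (w i) x)"
        using mesh_int_single_element[OF zi(2), of "\<lambda>i x. (P (val h0 i x) *v val (u t) i x) $ j" "monom 1 n"]
        by (simp add: f_def zi(1) w_def poly_monom)
      \<comment> \<open>The first summand is the velocity equation tested with \<open>w\<close> and
        integrates to 0.\<close>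
      also have "\<dots> = mesh_int N X (\<lambda>i x. (P (val (h t) i x) *v val (u t) i x - val (q t) i x) $ j * poly (w i) x
          + (val (q t) i x - P (val (h t) i x - val h0 i x) *v val (u t) i x) $ j * poly (w i) x)"
        by (intro mesh_int_cong) (simp add: P.diff_left algebra_simps)
      also have "\<dots> = mesh_int N X
        (\<lambda>i x. (val (q t) i x - P (val (h t) i x - val h0 i x) *v val (u t) i x) $ j * poly (w i) x)"
        using vel[OF t] w
        by (subst mesh_int_add) (auto simp: velocity_eq_def intro!: continuous_intros)
      finally show "f z (u t) = \<dots>" .
    qed
  qed
  show ?thesis
  proof (rule dominated_elementwise[OF m])
    fix i assume i: "i < N"
    have "dominated A m (\<lambda>t i' x. val (u t) i x)"
    proof (rule dominated_componentwise)
      fix j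
      have "dominated A m (\<lambda>t i' x. \<Sum>n\<le>k. (\<Sum>z\<in>I. c i j n z * f z (u t)) * x ^ n)"
        by (intro dominated_sum dominated_mult_left[OF bounded_bilinear_mult] dominated_cmult df dominated_static continuous_intros)
      then show "dominated A m (\<lambda>t i' x. val (u t) i x $ j)"
      proof (rule dominated_cong)
        fix t x assume t: "t \<in> A"
        have "val (u t) i x $ j = (\<Sum>n\<le>k. coeff (u t i $ j) n * x ^ n)"
          unfolding val_nth poly_altdef using u[OF t] i
          by (intro sum.mono_neutral_left) (auto simp: DGvec_iff coeff_eq_0)
        then show "val (u t) i x $ j = (\<Sum>n\<le>k. (\<Sum>z\<in>I. c i j n z * f z (u t)) * x ^ n)"
          by (simp add: c[OF i u[OF t]])
      qed
    qed
    then show "\<exists>c. \<forall>t\<in>A. \<forall>x\<in>{X i..X (Suc i)}. norm (val (u t) i x) \<le> c * m t"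
      using i unfolding dominated_def by blast
  qed
qed

section \<open>Gronwall estimate for the deviation from rest\<close>

lemma avg_inner_P: "avg N X (\<lambda>i' x. (P z *v val h i' x) \<bullet> val v i' x) i =
    1/2 * ((P z *v trace_plus N X (val h) i) \<bullet> trace_plus N X (val v) i
      + (P z *v trace_minus X (val h) i) \<bullet> trace_minus X (val v) i)"
  and jump_inner_P: "jump N X (\<lambda>i' x. (P z *v val h i' x) \<bullet> val v i' x) i =
    (P z *v trace_plus N X (val h) i) \<bullet> trace_plus N X (val v) i
      - (P z *v trace_minus X (val h) i) \<bullet> trace_minus X (val v) i"
  by (simp_all add: avg_def jump_def trace_plus_def trace_minus_def)

lemma has_time_deriv_continuous_on:
  assumes "has_time_deriv N X T a a'" "i < N" "x \<in> {X i..X (Suc i)}"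
  shows "continuous_on {0..T} (\<lambda>t. val (a t) i x)"
  using assms by (intro continuous_on_vector_derivative[where f' = "\<lambda>t. val (a' t) i x"]) (auto simp: has_time_deriv_def)

text \<open>The fluxes enter through \<open>flux\<close> alone: they are as small as the velocity
  and the jump of \<open>h + B\<close>. One argument thus serves both flux families.\<close>

lemma lake_at_rest_preserved:
  fixes h q u :: "real \<Rightarrow> 'K dgvec" and fq fqu :: "real \<Rightarrow> nat \<Rightarrow> real^'K"
  assumes B: "B \<in> DGvec N k"
    and DG: "\<And>t. t \<in> {0..T} \<Longrightarrow> h t \<in> DGvec N k" "\<And>t. t \<in> {0..T} \<Longrightarrow> q t \<in> DGvec N k"
      "\<And>t. t \<in> {0..T} \<Longrightarrow> u t \<in> DGvec N k"
    and DGt: "\<And>t. t \<in> {0..T} \<Longrightarrow> ht t \<in> DGvec N k" "\<And>t. t \<in> {0..T} \<Longrightarrow> qt t \<in> DGvec N k"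
    and ht: "has_time_deriv N X T h ht" and qt: "has_time_deriv N X T q qt"
    and cu: "\<And>i x. i < N \<Longrightarrow> x \<in> {X i..X (Suc i)} \<Longrightarrow> continuous_on {0..T} (\<lambda>t. val (u t) i x)"
    and mass: "\<And>t. t \<in> {0..T} \<Longrightarrow> mass_eq N X k (fq t) (ht t) (q t)"
    and mom: "\<And>t. t \<in> {0..T} \<Longrightarrow>
      momentum_eq P N X k g B (fq t) (fqu t) (ht t) (qt t) (h t) (q t) (u t)"
    and vel: "\<And>t. t \<in> {0..T} \<Longrightarrow> velocity_eq P N X k (h t) (q t) (u t)"
    and det: "velocity_determined P N X k (h 0)"
    and rest: "lake_at_rest N X B C (h 0) (q 0)"
    and flux: "\<And>m. \<lbrakk>dominated {0..T} (\<lambda>_. 1) (\<lambda>t. val (h t)); dominated {0..T} (\<lambda>_. 1) (\<lambda>t. val (u t));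
        dominated {0..T} m (\<lambda>t. val (u t));
        dominated {0..T} m (\<lambda>t i x. jump N X (\<lambda>i x. val (h t) i x + val B i x) i)\<rbrakk> \<Longrightarrow>
        dominated {0..T} m (\<lambda>t i x. fq t i) \<and> dominated {0..T} m (\<lambda>t i x. fqu t i)"
    and t: "t \<in> {0..T}"
  shows "lake_at_rest N X B C (h t) (q t)"
proof -
  define \<eta> where "\<eta> t = (\<lambda>i. h t i + B i - (\<chi> j. [:C $ j:]))" for t
  define m where "m t = sqrt ((L2_norm (\<eta> t))\<^sup>2 + (L2_norm (q t))\<^sup>2)" for t
  let ?A = "{0..T}"
  have DG_\<eta>: "\<eta> t \<in> DGvec N k" if "t \<in> ?A" for t
    using DGvec_diff[OF DGvec_add[OF DG(1)[OF that] B], of "\<lambda>i. \<chi> j. [:C $ j:]"]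
    by (simp add: \<eta>_def DGvec_iff)
  have val_\<eta>: "val (\<eta> t) i x = val (h t) i x + val B i x - C" for t i x
    by (simp add: \<eta>_def val_def vec_eq_iff)
  have dx_\<eta>: "dx (\<eta> t) i x = dx (h t) i x + dx B i x" for t i x
    by (simp add: \<eta>_def dx_def vec_eq_iff pderiv_add pderiv_diff)
  have jump_\<eta>: "jump N X (\<lambda>i x. val (h t) i x + val B i x) i = jump N X (val (\<eta> t)) i" for t i
    by (simp add: jump_def trace_plus_def trace_minus_def val_\<eta>)
  \<comment> \<open>\<open>B\<close> and \<open>C\<close> do not depend on time, so the deviation
    inherits the derivative of \<open>h\<close>.\<close>
  have \<eta>t: "has_time_deriv N X T \<eta> ht"
    using ht by (auto simp: has_time_deriv_def val_\<eta> intro!: derivative_eq_intros)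
  have m_nonneg: "0 \<le> m t" for t by (simp add: m_def)

  have ch: "continuous_on ?A (\<lambda>t. val (h t) i x)" and cq: "continuous_on ?A (\<lambda>t. val (q t) i x)"
    and c\<eta>: "continuous_on ?A (\<lambda>t. val (\<eta> t) i x)"
    if "i < N" "x \<in> {X i..X (Suc i)}" for i x
    using has_time_deriv_continuous_on[OF ht that] has_time_deriv_continuous_on[OF qt that]
      has_time_deriv_continuous_on[OF \<eta>t that] .
  \<comment> \<open>Coarse bounds, with constants depending on the given solution; Gronwall's
    inequality needs only some finite constant.\<close>
  have bh: "dominated ?A (\<lambda>_. 1) (\<lambda>t. val (h t))"
    using dominated_trans[OF dominated_L2(1)[OF DG(1)] L2_norm_bounded[OF DG(1) ch]] by blast
  have bu: "dominated ?A (\<lambda>_. 1) (\<lambda>t. val (u t))"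
    using dominated_trans[OF dominated_L2(1)[OF DG(3)] L2_norm_bounded[OF DG(3) cu]] by blast
  have bdu: "dominated ?A (\<lambda>_. 1) (\<lambda>t. dx (u t))"
    using dominated_trans[OF dominated_L2(2)[OF DG(3)] L2_norm_bounded[OF DG(3) cu]] by blast
  have bq: "dominated ?A (\<lambda>_. 1) (\<lambda>t. val (q t))"
    using dominated_trans[OF dominated_L2(1)[OF DG(2)] L2_norm_bounded[OF DG(2) cq]] by blast
  have bm: "dominated ?A (\<lambda>_. 1) (\<lambda>t i x. m t)"
  proof -
    have "dominated ?A (\<lambda>_. 1) (\<lambda>t i x. L2_norm (\<eta> t) + L2_norm (q t))"
      using L2_norm_bounded[OF DG_\<eta> c\<eta>] L2_norm_bounded[OF DG(2) cq] by (intro dominated_add) blast+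
    then obtain c where c: "\<And>t i x. t \<in> ?A \<Longrightarrow> i < N \<Longrightarrow> x \<in> {X i..X (Suc i)} \<Longrightarrow>
        norm (L2_norm (\<eta> t) + L2_norm (q t)) \<le> c * 1" by (rule dominatedE) blast
    have "m t \<le> L2_norm (\<eta> t) + L2_norm (q t)" for t
      unfolding m_def by (rule sqrt_sum_squares_le_sum) (simp_all add: L2_norm_nonneg)
    then show ?thesis
      using c m_nonneg by (intro dominatedI[where c = c]) (fastforce intro: order_trans)
  qed
  have L2_m: "dominated ?A m (\<lambda>t i x. L2_norm (\<eta> t))" "dominated ?A m (\<lambda>t i x. L2_norm (q t))"
    by (auto intro!: dominatedI[where c = 1] simp: m_def L2_norm_nonneg)
  have d\<eta>: "dominated ?A m (\<lambda>t. val (\<eta> t))" and dd\<eta>: "dominated ?A m (\<lambda>t. dx (\<eta> t))"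
    using dominated_trans[OF dominated_L2(1)[OF DG_\<eta>] L2_m(1)] dominated_trans[OF dominated_L2(2)[OF DG_\<eta>] L2_m(1)] by blast+
  have dq: "dominated ?A m (\<lambda>t. val (q t))" and ddq: "dominated ?A m (\<lambda>t. dx (q t))"
    using dominated_trans[OF dominated_L2(1)[OF DG(2)] L2_m(2)] dominated_trans[OF dominated_L2(2)[OF DG(2)] L2_m(2)] by blast+
  \<comment> \<open>At time 0 the surface level is \<open>C\<close> pointwise, so
    \<open>h - h 0\<close> is exactly the deviation \<open>\<eta>\<close>.\<close>
  have dh: "dominated ?A m (\<lambda>t i x. val (h t) i x - val (h 0) i x)"
  proof (rule dominated_cong[OF d\<eta>])
    fix t i x assume "i < N" "x \<in> {X i..X (Suc i)}"
    then have "C = val (h 0) i x + val B i x" using rest by (simp add: lake_at_rest_def)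
    then show "val (h t) i x - val (h 0) i x = val (\<eta> t) i x" by (simp add: val_\<eta>)
  qed
  have du: "dominated ?A m (\<lambda>t. val (u t))"
    using velocity_dominated[OF det DG(3) vel m_nonneg dq dh bu] by blast
  have dj: "dominated ?A m (\<lambda>t i x. jump N X (\<lambda>i x. val (h t) i x + val B i x) i)"
    unfolding jump_\<eta> by (rule dominated_jump[OF d\<eta>])
  have dfq: "dominated ?A m (\<lambda>t i x. fq t i)" and dfqu: "dominated ?A m (\<lambda>t i x. fqu t i)"
    using flux[OF bh bu du dj] by blast+
  have bfq: "dominated ?A (\<lambda>_. 1) (\<lambda>t i x. fq t i)"
    using dominated_trans[OF dfq bm] .

  note inner = dominated_bilinear[OF bounded_bilinear_inner]
  note P_left = dominated_mult_left[OF bounded_bilinear_P] and P_right = dominated_mult_right[OF bounded_bilinear_P]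
  \<comment> \<open>\<open>ht\<close> is not known to be continuous in time, so its bound comes from
    the mass equation tested with \<open>ht\<close> itself: its squared norm is at most a multiple
    of its norm. It is needed in \<open>P ht u . q\<close>, whose two small factors are
    \<open>u\<close> and \<open>q\<close>.\<close>
  have bht: "dominated ?A (\<lambda>_. 1) (\<lambda>t. val (ht t))"
  proof -
    \<comment> \<open>The factor 1 matches the product of sizes produced by
      \<open>dominated_bilinear\<close>.\<close>
    let ?l = "\<lambda>t. 1 * L2_norm (ht t)"
    have l: "dominated ?A (\<lambda>t. L2_norm (ht t)) (\<lambda>t. val (ht t))" "dominated ?A (\<lambda>t. L2_norm (ht t)) (\<lambda>t. dx (ht t))"
      by (rule dominated_L2, erule DGt(1))+
    have "dominated ?A ?l (\<lambda>t i x. mesh_int N X (\<lambda>i x. val (q t) i x \<bullet> dx (ht t) i x)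
        + (\<Sum>i<N. fq t i \<bullet> jump N X (val (ht t)) i))"
      by (intro dominated_add dominated_mesh_int[OF inner[OF bq l(2)]]
          dominated_interface_sum[OF inner[OF bfq dominated_jump[OF l(1)]]])
    then have "dominated ?A ?l (\<lambda>t i x. (L2_norm (ht t))\<^sup>2)"
      by (rule dominated_cong) (simp only: L2_norm_squared mass_eq_inner[OF mass DGt(1)])
    then obtain c where c: "\<And>t i x. t \<in> ?A \<Longrightarrow> i < N \<Longrightarrow> x \<in> {X i..X (Suc i)} \<Longrightarrow> norm ((L2_norm (ht t))\<^sup>2) \<le> c * (1 * L2_norm (ht t))"
      by (rule dominatedE) blast
    have "L2_norm (ht t) \<le> \<bar>c\<bar>" if "t \<in> ?A" for t
      using c[OF that N_pos left_end_in[OF N_pos]] L2_norm_nonneg[of "ht t"]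
      by (cases "L2_norm (ht t) = 0") (auto simp: power2_eq_square)
    then have "dominated ?A (\<lambda>_. 1) (\<lambda>t i x. L2_norm (ht t))"
      using L2_norm_nonneg by (intro dominatedI[where c = "\<bar>c\<bar>"]) simp
    then show ?thesis using dominated_trans[OF l(1)] by blast
  qed

  \<comment> \<open>Tested with \<open>\<eta>\<close> and \<open>q\<close>, every term of the mass
    and momentum equations contains two factors of size \<open>m\<close>, so \<open>Z'\<close> is
    bounded by a multiple of the squared \<open>m\<close>.\<close>
  define Z' where "Z' t = 2 * mesh_int N X (\<lambda>i x. val (ht t) i x \<bullet> val (\<eta> t) i x)
      + 2 * mesh_int N X (\<lambda>i x. val (qt t) i x \<bullet> val (q t) i x)" for t
  have Z: "((\<lambda>t. (m t)\<^sup>2) has_real_derivative Z' t) (at t within ?A)" if t: "t \<in> ?A" for t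
    unfolding Z'_def m_def
    using DERIV_add[OF L2_norm_has_derivative[OF t DG_\<eta> DGt(1)[OF t] \<eta>t] L2_norm_has_derivative[OF t DG(2) DGt(2)[OF t] qt]]
    by simp
  have "dominated ?A (\<lambda>t. m t * m t) (\<lambda>t i x. mesh_int N X (\<lambda>i x. val (ht t) i x \<bullet> val (\<eta> t) i x))"
  proof (rule dominated_cong[OF _ mass_eq_inner[OF mass DG_\<eta>]])
    show "dominated ?A (\<lambda>t. m t * m t) (\<lambda>t i x. mesh_int N X (\<lambda>i x. val (q t) i x \<bullet> dx (\<eta> t) i x)
        + (\<Sum>i<N. fq t i \<bullet> jump N X (val (\<eta> t)) i))"
      by (intro dominated_add dominated_mesh_int[OF inner[OF dq dd\<eta>]]
          dominated_interface_sum[OF inner[OF dfq dominated_jump[OF d\<eta>]]])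
  qed
  moreover have "dominated ?A (\<lambda>t. m t * m t) (\<lambda>t i x. mesh_int N X (\<lambda>i x. val (qt t) i x \<bullet> val (q t) i x))"
  proof (rule dominated_cong[OF _ momentum_eq_inner[OF mom DG(2)]], goal_cases)
    case 1
    show ?case
      unfolding avg_inner_P jump_inner_P jump_\<eta> dx_\<eta>[symmetric]
      by (intro dominated_add dominated_diff dominated_cmult
          dominated_mesh_int[OF inner[OF P_left[OF dq bu] ddq]]
          dominated_mesh_int[OF inner[OF P_left[OF dq bdu] dq]]
          dominated_interface_sum[OF inner[OF dfqu dominated_jump[OF dq]]]
          dominated_mesh_int[OF inner[OF P_left[OF dd\<eta> bh] dq]]
          dominated_mesh_int[OF inner[OF P_right[OF bht du] dq]]
          dominated_interface_sum inner[OF P_left[OF dominated_jump[OF d\<eta>]]]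
          inner[OF P_left[OF dfq]] dominated_traces bh bu dq)
  qed
  ultimately have "dominated ?A (\<lambda>t. m t * m t) (\<lambda>t i x. Z' t)"
    unfolding Z'_def by (intro dominated_add dominated_cmult)
  then obtain c where c: "\<And>t i x. t \<in> ?A \<Longrightarrow> i < N \<Longrightarrow> x \<in> {X i..X (Suc i)} \<Longrightarrow> norm (Z' t) \<le> c * (m t * m t)"
    by (rule dominatedE) blast
  have val0: "val (\<eta> 0) i x = 0" "val (q 0) i x = 0" if "i < N" "x \<in> {X i..X (Suc i)}" for i x
    using rest that by (auto simp: lake_at_rest_def val_\<eta>)
  then have "mesh_int N X (\<lambda>i x. val (\<eta> 0) i x \<bullet> val (\<eta> 0) i x) = mesh_int N X (\<lambda>i x. 0)"
    "mesh_int N X (\<lambda>i x. val (q 0) i x \<bullet> val (q 0) i x) = mesh_int N X (\<lambda>i x. 0)"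
    by (auto intro!: mesh_int_cong)
  then have m0: "(m 0)\<^sup>2 = 0"
    by (simp add: m_def L2_norm_squared mesh_int_def)
  have "(m t)\<^sup>2 = 0"
  proof (rule gronwall_zero[OF Z _ _ m0 t])
    fix t assume "t \<in> ?A"
    then show "Z' t \<le> c * (m t)\<^sup>2"
      using c[OF _ N_pos left_end_in[OF N_pos], of t] by (simp add: power2_eq_square)
  qed auto
  then have "m t = 0" by simp
  then have "val (\<eta> t) i x = 0" "val (q t) i x = 0" if "i < N" "x \<in> {X i..X (Suc i)}" for i x
    using dominatedE[OF d\<eta>] dominatedE[OF dq] t that by (metis mult_zero_right norm_le_zero_iff)+
  then show ?thesis by (auto simp: lake_at_rest_def val_\<eta>)
qed

text \<open>\<open>central_fq\<close> is linear in \<open>u\<close> with bounded coefficients.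
  \<open>central_fqu\<close> is quadratic in \<open>u\<close>, so one factor is merely bounded and
  the other supplies the size \<open>m\<close>.\<close>

lemma central_flux_dominated:
  assumes bh: "dominated A (\<lambda>_. 1) (\<lambda>t. val (h t))" and bu: "dominated A (\<lambda>_. 1) (\<lambda>t. val (u t))"
    and du: "dominated A m (\<lambda>t. val (u t))"
  shows "dominated A m (\<lambda>t i x. central_fq P N X (h t) (u t) i)"
    "dominated A m (\<lambda>t i x. central_fqu P N X (h t) (u t) i)"
  unfolding central_fq_def central_fqu_def
  using dominated_avg[OF dominated_mult_right[OF bounded_bilinear_P bh du]]
    dominated_mult_right[OF bounded_bilinear_P
      dominated_avg[OF dominated_mult_right[OF bounded_bilinear_P bh bu]] dominated_avg[OF du]]
  by simp_all

text \<open>The two penalties are small for different reasons: the one in \<open>lf_fq\<close> as a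
  jump of \<open>h + B\<close>, the one in \<open>lf_fqu\<close> through \<open>u\<close>, with
  \<open>h + B\<close> only bounded.\<close>

lemma lf_flux_dominated:
  assumes bh: "dominated A (\<lambda>_. 1) (\<lambda>t. val (h t))" and bu: "dominated A (\<lambda>_. 1) (\<lambda>t. val (u t))"
    and du: "dominated A m (\<lambda>t. val (u t))"
    and dj: "dominated A m (\<lambda>t i x. jump N X (\<lambda>i x. val (h t) i x + val B i x) i)"
  shows "dominated A m (\<lambda>t i x. lf_fq P N X B \<alpha> (h t) (u t) i)"
    "dominated A m (\<lambda>t i x. lf_fqu P N X B \<alpha> (h t) (u t) i)"
proof -
  have b: "dominated A (\<lambda>_. 1) (\<lambda>t i x. val (h t) i x + val B i x)"
    by (intro dominated_add bh dominated_static continuous_intros)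
  show "dominated A m (\<lambda>t i x. lf_fq P N X B \<alpha> (h t) (u t) i)"
    using dominated_diff[OF central_flux_dominated(1)[OF bh bu du] dominated_scaleR[OF dj]]
    unfolding lf_fq_def central_fq_def by blast
  show "dominated A m (\<lambda>t i x. lf_fqu P N X B \<alpha> (h t) (u t) i)"
    using dominated_diff[OF central_flux_dominated(2)[OF bh bu du]
        dominated_scaleR[OF dominated_jump[OF dominated_mult_right[OF bounded_bilinear_P b du]]]]
    unfolding lf_fqu_def central_fqu_def by blast
qed

end

lemma galerkin_mesh_pc_matrix:
  fixes \<psi> :: "'K::finite \<Rightarrow> real^'d \<Rightarrow> real"
  assumes "periodic_mesh N X"
  shows "galerkin_mesh (pc_matrix \<rho> \<psi>) N X"
proof (rule galerkin_mesh.intro)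
  show "linear (pc_matrix \<rho> \<psi>)"
    unfolding pc_matrix_def[abs_def]
    by (intro linearI) (simp_all add: scaleR_add_left sum.distrib scaleR_sum_right)
  fix a b :: "real^'K"
  have nth: "pc_matrix \<rho> \<psi> a $ l $ n = (\<Sum>k\<in>UNIV. a $ k * ip \<rho> (\<psi> k) (\<lambda>s. \<psi> l s * \<psi> n s))" for a l n
    by (simp add: pc_matrix_def triple_matrix_def)
  show "transpose (pc_matrix \<rho> \<psi> a) = pc_matrix \<rho> \<psi> a"
    by (simp add: vec_eq_iff transpose_def nth ip_def mult.commute mult.left_commute)
  have "(\<Sum>n\<in>UNIV. (\<Sum>k\<in>UNIV. a $ k * ip \<rho> (\<psi> k) (\<lambda>s. \<psi> l s * \<psi> n s)) * b $ n) =
      (\<Sum>k\<in>UNIV. (\<Sum>n\<in>UNIV. b $ n * ip \<rho> (\<psi> n) (\<lambda>s. \<psi> l s * \<psi> k s)) * a $ k)" for l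
  proof -
    \<comment> \<open>The integrand is a product of three basis functions and the density, hence
      symmetric in the three indices.\<close>
    have "ip \<rho> (\<psi> k) (\<lambda>s. \<psi> l s * \<psi> n s) = ip \<rho> (\<psi> n) (\<lambda>s. \<psi> l s * \<psi> k s)" for k n
      by (simp add: ip_def mult_ac)
    then show ?thesis
      unfolding sum_distrib_right by (subst sum.swap) (simp add: mult_ac)
  qed
  then show "pc_matrix \<rho> \<psi> a *v b = pc_matrix \<rho> \<psi> b *v a"
    by (simp add: vec_eq_iff matrix_vector_mult_def nth)
qed (rule assms)

theorem theorem3:
  fixes \<rho> :: "real^'d \<Rightarrow> real"
    and \<phi> :: "nat \<Rightarrow> real^'d \<Rightarrow> real"
    and \<iota> :: "'K::finite \<Rightarrow> nat"
    and P :: "real^'K \<Rightarrow> real^'K^'K"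
    and N k :: nat and X :: "nat \<Rightarrow> real"
    and g T :: real
    and B :: "'K dgvec"
  assumes "prob_density_moments \<rho>"
    and "orthonormal_poly_seq \<rho> \<phi>"
    and "bij_betw \<iota> UNIV {1..CARD('K)}"
    and "P = pc_matrix \<rho> (\<lambda>j. \<phi> (\<iota> j))"
    and "periodic_mesh N X"
    and "0 < g" and "0 < T"
    and "B \<in> DGvec N k"
  shows
    \<comment> \<open>well-balanced, central fluxes\<close>
    "(\<forall>h q u C.
        dg_sg_solution P N X k g T B (central_fq P N X) (central_fqu P N X) h q u \<and>
        velocity_determined P N X k (h 0) \<and> lake_at_rest N X B C (h 0) (q 0) \<longrightarrow>
        (\<forall>t\<in>{0..T}. lake_at_rest N X B C (h t) (q t))) \<and>
     \<comment> \<open>well-balanced, Lax--Friedrichs type fluxes\<close>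
     (\<forall>\<alpha>\<ge>0. \<forall>h q u C.
        dg_sg_solution P N X k g T B (lf_fq P N X B \<alpha>) (lf_fqu P N X B \<alpha>) h q u \<and>
        velocity_determined P N X k (h 0) \<and> lake_at_rest N X B C (h 0) (q 0) \<longrightarrow>
        (\<forall>t\<in>{0..T}. lake_at_rest N X B C (h t) (q t))) \<and>
     \<comment> \<open>entropy conservative, central fluxes\<close>
     (\<forall>h q u.
        dg_sg_solution P N X k g T B (central_fq P N X) (central_fqu P N X) h q u \<longrightarrow>
        (\<forall>t\<in>{0..T}. ((\<lambda>s. entropy N X g B (h s) (q s) (u s)) has_real_derivative 0)
                        (at t within {0..T}))) \<and>
     \<comment> \<open>entropy stable, Lax--Friedrichs type fluxes\<close>
     (\<forall>\<alpha>\<ge>0. \<forall>h q u.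
        dg_sg_solution P N X k g T B (lf_fq P N X B \<alpha>) (lf_fqu P N X B \<alpha>) h q u \<longrightarrow>
        (\<forall>t\<in>{0..T}.
           (\<forall>i<N. pos_semidef (P (avg N X (\<lambda>i x. val (h t) i x + val B i x) i))) \<longrightarrow>
           (\<exists>D\<le>0. ((\<lambda>s. entropy N X g B (h s) (q s) (u s)) has_real_derivative D)
                      (at t within {0..T}))))"
proof -
  interpret galerkin_mesh P N X
    unfolding assms(4) by (rule galerkin_mesh_pc_matrix[OF assms(5)])
  note B = \<open>B \<in> DGvec N k\<close>
  have solution: "\<exists>ht qt. (\<forall>t\<in>{0..T}. h t \<in> DGvec N k \<and> q t \<in> DGvec N k \<and> u t \<in> DGvec N k \<and>
        ht t \<in> DGvec N k \<and> qt t \<in> DGvec N k) \<and>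
      has_time_deriv N X T h ht \<and> has_time_deriv N X T q qt \<and>
      (\<forall>i x. i < N \<longrightarrow> x \<in> {X i..X (Suc i)} \<longrightarrow> continuous_on {0..T} (\<lambda>t. val (u t) i x)) \<and>
      (\<forall>t\<in>{0..T}. mass_eq N X k (Fq (h t) (u t)) (ht t) (q t) \<and>
         momentum_eq P N X k g B (Fq (h t) (u t)) (Fqu (h t) (u t)) (ht t) (qt t) (h t) (q t) (u t) \<and>
         velocity_eq P N X k (h t) (q t) (u t))"
    if "dg_sg_solution P N X k g T B Fq Fqu h q u" for Fq Fqu h q u
    using that unfolding dg_sg_solution_def by blast
  \<comment> \<open>Stated for arbitrary flux maps; the two families differ only in how
    \<open>flux\<close> is verified.\<close>
  have well_balanced: "lake_at_rest N X B C (h t) (q t)"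
    if sol: "dg_sg_solution P N X k g T B Fq Fqu h q u"
      and det: "velocity_determined P N X k (h 0)" and rest: "lake_at_rest N X B C (h 0) (q 0)"
      and t: "t \<in> {0..T}"
      and flux: "\<And>m. \<lbrakk>dominated {0..T} (\<lambda>_. 1) (\<lambda>t. val (h t)); dominated {0..T} (\<lambda>_. 1) (\<lambda>t. val (u t));
        dominated {0..T} m (\<lambda>t. val (u t));
        dominated {0..T} m (\<lambda>t i x. jump N X (\<lambda>i x. val (h t) i x + val B i x) i)\<rbrakk> \<Longrightarrow>
        dominated {0..T} m (\<lambda>t i x. Fq (h t) (u t) i) \<and> dominated {0..T} m (\<lambda>t i x. Fqu (h t) (u t) i)"
    for Fq Fqu h q u C t
  proof -
    obtain ht qt where s: "\<forall>t\<in>{0..T}. h t \<in> DGvec N k \<and> q t \<in> DGvec N k \<and> u t \<in> DGvec N k \<and>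
        ht t \<in> DGvec N k \<and> qt t \<in> DGvec N k"
      "has_time_deriv N X T h ht" "has_time_deriv N X T q qt"
      "\<forall>i x. i < N \<longrightarrow> x \<in> {X i..X (Suc i)} \<longrightarrow> continuous_on {0..T} (\<lambda>t. val (u t) i x)"
      "\<forall>t\<in>{0..T}. mass_eq N X k (Fq (h t) (u t)) (ht t) (q t) \<and>
         momentum_eq P N X k g B (Fq (h t) (u t)) (Fqu (h t) (u t)) (ht t) (qt t) (h t) (q t) (u t) \<and>
         velocity_eq P N X k (h t) (q t) (u t)"
      using solution[OF sol] by blast
    show ?thesis
      by (rule lake_at_rest_preserved[where ht = ht and qt = qt and u = u and g = g
            and fq = "\<lambda>t. Fq (h t) (u t)" and fqu = "\<lambda>t. Fqu (h t) (u t)",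
            OF B _ _ _ _ _ s(2,3) _ _ _ _ det rest _ t])
        (use s flux in blast)+
  qed
  have rate: "\<exists>ht qt. ((\<lambda>s. entropy N X g B (h s) (q s) (u s)) has_real_derivative
        entropy_rate g B ht qt (h t) (u t)) (at t within {0..T}) \<and>
      h t \<in> DGvec N k \<and> u t \<in> DGvec N k \<and> mass_eq N X k (Fq (h t) (u t)) ht (q t) \<and>
      momentum_eq P N X k g B (Fq (h t) (u t)) (Fqu (h t) (u t)) ht qt (h t) (q t) (u t) \<and>
      velocity_eq P N X k (h t) (q t) (u t)"
    if sol: "dg_sg_solution P N X k g T B Fq Fqu h q u" and t: "t \<in> {0..T}" for Fq Fqu h q u t
  proof -
    obtain ht qt where s: "\<forall>t\<in>{0..T}. h t \<in> DGvec N k \<and> q t \<in> DGvec N k \<and> u t \<in> DGvec N k \<and>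
        ht t \<in> DGvec N k \<and> qt t \<in> DGvec N k"
      "has_time_deriv N X T h ht" "has_time_deriv N X T q qt"
      "\<forall>i x. i < N \<longrightarrow> x \<in> {X i..X (Suc i)} \<longrightarrow> continuous_on {0..T} (\<lambda>t. val (u t) i x)"
      "\<forall>t\<in>{0..T}. mass_eq N X k (Fq (h t) (u t)) (ht t) (q t) \<and>
         momentum_eq P N X k g B (Fq (h t) (u t)) (Fqu (h t) (u t)) (ht t) (qt t) (h t) (q t) (u t) \<and>
         velocity_eq P N X k (h t) (q t) (u t)"
      using solution[OF sol] by blast
    have "((\<lambda>s. entropy N X g B (h s) (q s) (u s)) has_real_derivative
        entropy_rate g B (ht t) (qt t) (h t) (u t)) (at t within {0..T})"
      by (rule entropy_has_real_derivative[OF t B _ _ _ s(2,3)]) (use s t in blast)+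
    then show ?thesis using s(1,5) t by blast
  qed
  show ?thesis
  proof (intro conjI allI impI ballI; (elim conjE)?)
    fix h q u C t
    assume "dg_sg_solution P N X k g T B (central_fq P N X) (central_fqu P N X) h q u"
      "velocity_determined P N X k (h 0)" "lake_at_rest N X B C (h 0) (q 0)" "t \<in> {0..T}"
    then show "lake_at_rest N X B C (h t) (q t)"
      by (rule well_balanced) (blast intro: central_flux_dominated)
  next
    fix \<alpha> :: real and h q u C t
    assume "dg_sg_solution P N X k g T B (lf_fq P N X B \<alpha>) (lf_fqu P N X B \<alpha>) h q u"
      "velocity_determined P N X k (h 0)" "lake_at_rest N X B C (h 0) (q 0)" "t \<in> {0..T}"
    then show "lake_at_rest N X B C (h t) (q t)"
      by (rule well_balanced) (blast intro: lf_flux_dominated)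
  next
    fix h q u t
    assume "dg_sg_solution P N X k g T B (central_fq P N X) (central_fqu P N X) h q u" "t \<in> {0..T}"
    from rate[OF this] show "((\<lambda>s. entropy N X g B (h s) (q s) (u s)) has_real_derivative 0) (at t within {0..T})"
      using entropy_rate_central[OF _ _ B] by metis
  next
    fix \<alpha> :: real and h q u t
    assume \<alpha>: "0 \<le> \<alpha>"
      and "dg_sg_solution P N X k g T B (lf_fq P N X B \<alpha>) (lf_fqu P N X B \<alpha>) h q u" "t \<in> {0..T}"
      and psd: "\<forall>i<N. pos_semidef (P (avg N X (\<lambda>i x. val (h t) i x + val B i x) i))"
    then obtain ht qt where r: "((\<lambda>s. entropy N X g B (h s) (q s) (u s)) has_real_derivative
        entropy_rate g B ht qt (h t) (u t)) (at t within {0..T})"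
      "h t \<in> DGvec N k" "u t \<in> DGvec N k" "mass_eq N X k (lf_fq P N X B \<alpha> (h t) (u t)) ht (q t)"
      "momentum_eq P N X k g B (lf_fq P N X B \<alpha> (h t) (u t)) (lf_fqu P N X B \<alpha> (h t) (u t)) ht qt (h t) (q t) (u t)"
      "velocity_eq P N X k (h t) (q t) (u t)"
      using rate by blast
    have "entropy_rate g B ht qt (h t) (u t) \<le> 0"
      using entropy_rate_lf[OF r(2,3) B r(4-6) \<alpha>] psd \<open>0 < g\<close> by simp
    then show "\<exists>D\<le>0. ((\<lambda>s. entropy N X g B (h s) (q s) (u s)) has_real_derivative D) (at t within {0..T})"
      using r(1) by blast
  qed
qed

end
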